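(* Let $\mathbf a=\{a_j\}_{j\ge1}$ and $\mathbf b=\{b_j\}_{j\ge1}$ be arbitrary sequences of positive real numbers and let $d\in\mathbb N$. Then $$\lim_{n\to\infty} n^{g_d(\mathbf b)}\, a_n\big(I_d: W_2^{\mathbf a,\mathbf b}([0,1]^d)\to L_2([0,1]^d)\big)=\big(\mathrm{vol}(B^d_{\mathbf a,2\mathbf b})\big)^{g_d(\mathbf b)},$$ where $g_d(\mathbf b)=\big(\frac1{b_1}+\cdots+\frac1{b_d}\big)^{-1}$.
   Context: For $f\in L_2([0,1]^d)$ let $\hat f(\mathbf k)=\int_{[0,1]^d} f(\mathbf x)e^{-2\pi i \mathbf k\cdot\mathbf x}\,d\mathbf x$, $\mathbf k\in\mathbb Z^d$. For positive sequences $\mathbf a,\mathbf b$, the weighted anisotropic Sobolev space $W_2^{\mathbf a,\mathbf b}([0,1]^d)$ is the Hilbert space of $f\in L_2([0,1]^d)$ with finite norm $\|f\|_{W_2^{\mathbf a,\mathbf b}}=\big(\sum_{\mathbf k\in\mathbb Z^d}(1+\sum_{j=1}^d a_j|k_j|^{2b_j})|\hat f(\mathbf k)|^2\big)^{1/2}$ (equivalently $\|f\|_2^2+\sum_j a_j(2\pi)^{-2b_j}\|D_j^{b_j}f\|_2^2$ with Weyl derivatives). $I_d$ denotes the identity (embedding) operator $W_2^{\mathbf a,\mathbf b}([0,1]^d)\to L_2([0,1]^d)$. For a bounded linear operator $T:X\to Y$, the approximation numbers are $a_n(T)=\inf\{\|T-A\|_{X\to Y}: \mathrm{rank}\,A<n\}$,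 $n\in\mathbb N$. For positive sequences $\mathbf a,\mathbf c$ and $t>0$, $B^d_{\mathbf a,\mathbf c}(t)=\{x\in\mathbb R^d:\sum_{j=1}^d a_j|x_j|^{c_j}\le t\}$ and $B^d_{\mathbf a,\mathbf c}=B^d_{\mathbf a,\mathbf c}(1)$; $2\mathbf b$ denotes the sequence $\{2b_j\}$; $\mathrm{vol}$ is Lebesgue measure. *)

theory Defs
  imports "HOL-Analysis.Analysis"
begin

definition cubeM :: "nat \<Rightarrow> (nat \<Rightarrow> real) measure" where
  "cubeM d = PiM {1..d} (\<lambda>_. restrict_space lborel {0..1::real})"

definition L2 :: "nat \<Rightarrow> ((nat \<Rightarrow> real) \<Rightarrow> complex) set" where
  "L2 d = {f. f \<in> borel_measurable (cubeM d) \<and>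
               integrable (cubeM d) (\<lambda>x. (cmod (f x))^2)}"

definition L2norm :: "nat \<Rightarrow> ((nat \<Rightarrow> real) \<Rightarrow> complex) \<Rightarrow> real" where
  "L2norm d f = sqrt (integral\<^sup>L (cubeM d) (\<lambda>x. (cmod (f x))^2))"

definition freq :: "nat \<Rightarrow> (nat \<Rightarrow> int) set" where
  "freq d = PiE {1..d} (\<lambda>_. UNIV)"

definition fourier :: "nat \<Rightarrow> ((nat \<Rightarrow> real) \<Rightarrow> complex) \<Rightarrow> (nat \<Rightarrow> int) \<Rightarrow> complex" where
  "fourier d f k = integral\<^sup>L (cubeM d)
      (\<lambda>x. f x * cis (- 2 * pi * (\<Sum>j\<in>{1..d}. real_of_int (k j) * x j)))"

definition sob_weight :: "(nat \<Rightarrow> real) \<Rightarrow> (nat \<Rightarrow> real) \<Rightarrow> nat \<Rightarrow> (nat \<Rightarrow> int) \<Rightarrow> real" where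
  "sob_weight a b d k = 1 + (\<Sum>j\<in>{1..d}. a j * \<bar>real_of_int (k j)\<bar> powr (2 * b j))"

definition Wspace :: "(nat \<Rightarrow> real) \<Rightarrow> (nat \<Rightarrow> real) \<Rightarrow> nat \<Rightarrow> ((nat \<Rightarrow> real) \<Rightarrow> complex) set" where
  "Wspace a b d = {f \<in> L2 d.
      (\<lambda>k. sob_weight a b d k * (cmod (fourier d f k))^2) summable_on freq d}"

definition Wnorm :: "(nat \<Rightarrow> real) \<Rightarrow> (nat \<Rightarrow> real) \<Rightarrow> nat \<Rightarrow> ((nat \<Rightarrow> real) \<Rightarrow> complex) \<Rightarrow> real" where
  "Wnorm a b d f = sqrt (infsum (\<lambda>k. sob_weight a b d k * (cmod (fourier d f k))^2) (freq d))"

text \<open>n-th approximation number of the embedding I_d : W_2^{a,b} -> L_2: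
  the infimum of ||I_d - A|| over (complex-)linear operators A : W -> L_2 of rank < n,
  where the operator norm ||I_d - A|| is written out as the least constant c >= 0 with
  ||f - A f||_{L_2} <= c ||f||_W for all f in W (elements of L_2 are identified a.e.).
  Rank < n means the range lies (a.e.) in the span of fewer than n L_2 functions.\<close>

definition approx_num :: "(nat \<Rightarrow> real) \<Rightarrow> (nat \<Rightarrow> real) \<Rightarrow> nat \<Rightarrow> nat \<Rightarrow> real" where
  "approx_num a b d n = Inf {c. c \<ge> 0 \<and> (\<exists>A :: ((nat \<Rightarrow> real) \<Rightarrow> complex) \<Rightarrow> ((nat \<Rightarrow> real) \<Rightarrow> complex).
      (\<forall>f\<in>Wspace a b d. A f \<in> L2 d) \<and>
      (\<forall>f\<in>Wspace a b d. \<forall>g\<in>Wspace a b d. \<forall>\<alpha> \<beta> :: complex.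
          AE x in cubeM d. A (\<lambda>y. \<alpha> * f y + \<beta> * g y) x = \<alpha> * A f x + \<beta> * A g x) \<and>
      (\<exists>G. finite G \<and> card G < n \<and> G \<subseteq> L2 d \<and>
          (\<forall>f\<in>Wspace a b d. \<exists>coef::((nat \<Rightarrow> real) \<Rightarrow> complex) \<Rightarrow> complex.
              AE x in cubeM d. A f x = (\<Sum>g\<in>G. coef g * g x))) \<and>
      (\<forall>f\<in>Wspace a b d. L2norm d (\<lambda>x. f x - A f x) \<le> c * Wnorm a b d f))}"

definition ball_vol :: "(nat \<Rightarrow> real) \<Rightarrow> (nat \<Rightarrow> real) \<Rightarrow> nat \<Rightarrow> real" where
  "ball_vol a b d = measure (PiM {1..d} (\<lambda>_. lborel))
     {x \<in> PiE {1..d} (\<lambda>_. UNIV). (\<Sum>j\<in>{1..d}. a j * \<bar>x j\<bar> powr (2 * b j)) \<le> 1}"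

definition g_exp :: "(nat \<Rightarrow> real) \<Rightarrow> nat \<Rightarrow> real" where
  "g_exp b d = 1 / (\<Sum>j\<in>{1..d}. 1 / b j)"

end

theory Submission
  imports Defs "HOL-Probability.Infinite_Product_Measure" "HOL-Library.Real_Mod"
begin

text \<open>
  The embedding is diagonal in the Fourier basis, so its approximation numbers are governed by the
  non-increasing rearrangement of the inverse square roots of the weights. Projecting onto the
  frequencies with small weight bounds them from above; this needs completeness of the
  trigonometric system. From below, a map of rank less than $n$ annihilates a nonzero
  trigonometric polynomial supported on any given $n$ frequencies.

  It remains to count the lattice points $k$ with $\sum_j a_j |k_j|^{2 b_j} \le t$. Their number is
  the volume of the set of $x$ whose coordinatewise floor lies in that ball. The dilation
  $x_j = t^{1/(2 b_j)} y_j$ has Jacobian $t^{1/(2 g_d(b))}$ and maps the unit ball onto the ball of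
  radius $t$. After dividing by it, the rounding error vanishes as $t$ grows, and dominated
  convergence gives the volume of the unit ball, since its boundary is a null set.
\<close>

section \<open>Trigonometric polynomials on the cube\<close>

text \<open>The counting function of the weights is never inverted. For a constant \<open>v\<close>
  close to the volume, the radius \<open>t n\<close> solves
  \<open>v * t n powr \<sigma> = n\<close>; so the lattice ball of radius \<open>t n\<close>
  eventually has fewer than \<open>n\<close> points if \<open>v\<close> exceeds the volume, and at
  least \<open>n\<close> if \<open>v\<close> lies below it. This pins the normalised approximation
  numbers to \<open>v powr g_exp b d\<close> from either side, and continuity of the power closes
  the gap. The summand 1 in the weight does no harm: weights are at least \<open>t\<close> outside
  the ball and at most \<open>1 + t\<close> inside, and \<open>t / (1 + t)\<close> tends to 1.
  Weights enter through square roots, hence \<open>g_exp b d = 1 / (2 * \<sigma>)\<close>. The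
  obstacle in the completeness proof is that exponentials identify 0 with 1 in each coordinate while
  the closed cube does not. Indicators of boxes can thus be reached only away from certain faces.
  These are null sets, so almost everywhere convergence under an integrable majorant carries the
  whole argument.\<close>

definition emode :: "nat \<Rightarrow> (nat \<Rightarrow> int) \<Rightarrow> (nat \<Rightarrow> real) \<Rightarrow> complex" where
  "emode d k x = cis (2 * pi * (\<Sum>j\<in>{1..d}. real_of_int (k j) * x j))"

lemma cis_sum: "finite I \<Longrightarrow> cis (sum f I) = (\<Prod>i\<in>I. cis (f i))"
  by (simp add: cis_conv_exp sum_distrib_left flip: exp_sum)

lemma emode_prod: "emode d k x = (\<Prod>j\<in>{1..d}. cis (2 * pi * real_of_int (k j) * x j))"
  by (simp add: emode_def sum_distrib_left mult.assoc flip: cis_sum)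

lemma cnj_emode: "cnj (emode d k x) = emode d (\<lambda>j. - k j) x"
  by (simp add: emode_def cis_cnj sum_negf)

lemma emode_mult: "emode d k x * emode d l x = emode d (\<lambda>j. k j + l j) x"
  by (simp add: emode_def cis_mult sum.distrib algebra_simps)

lemma emode_restrict: "emode d (restrict k {1..d}) = emode d k"
  by (simp add: emode_def fun_eq_iff)

lemma cmod_emode [simp]: "cmod (emode d k x) = 1"
  by (simp add: emode_def)

lemma fourier_eq: "fourier d f k = (\<integral>x. f x * cnj (emode d k x) \<partial>cubeM d)"
  by (simp add: fourier_def emode_def cis_cnj)

section \<open>The unit cube as a probability space and orthonormality of the exponentials\<close>

definition cube1 :: "real measure" where
  "cube1 = restrict_space lborel {0..1}"

lemma cubeM_eq: "cubeM d = PiM {1..d} (\<lambda>_. cube1)"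
  by (simp add: cubeM_def cube1_def)

lemma space_cube1 [simp]: "space cube1 = {0..1}"
  by (simp add: cube1_def space_restrict_space)

lemma sets_cube1: "sets cube1 = sets (restrict_space borel {0..1})"
  by (simp add: cube1_def sets_restrict_space)

lemma prob_space_cube1: "prob_space cube1"
  by (rule prob_spaceI) (simp add: cube1_def emeasure_restrict_space space_restrict_space)

interpretation cube1: prob_space cube1
  by (rule prob_space_cube1)

interpretation cubes: product_prob_space "\<lambda>_::nat. cube1" I for I
  by standard

lemma prob_space_cubeM: "prob_space (cubeM d)"
  unfolding cubeM_eq by (rule prob_space_PiM) (rule prob_space_cube1)

interpretation cubeM: prob_space "cubeM d" for d
  by (rule prob_space_cubeM)

lemma space_cubeM: "space (cubeM d) = PiE {1..d} (\<lambda>_. {0..1})"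
  by (simp add: cubeM_eq space_PiM)

lemma measurable_cube1_borel: "f \<in> borel_measurable borel \<Longrightarrow> f \<in> borel_measurable cube1"
  by (simp add: cube1_def measurable_restrict_space1)

lemma measurable_component_cubeM:
  "j \<in> {1..d} \<Longrightarrow> (\<lambda>x. x j) \<in> borel_measurable (cubeM d)"
  unfolding cubeM_eq
  by (rule measurable_compose[OF measurable_component_singleton[of j "{1..d}"]]) (auto intro: measurable_cube1_borel)

lemma emode_measurable [measurable]: "emode d k \<in> borel_measurable (cubeM d)"
proof -
  have "(\<lambda>x. \<Sum>j\<in>{1..d}. real_of_int (k j) * x j) \<in> borel_measurable (cubeM d)"
    by (intro borel_measurable_sum borel_measurable_times borel_measurable_const
          measurable_component_cubeM)
  then have "(\<lambda>x. complex_of_real (2 * pi * (\<Sum>j\<in>{1..d}. real_of_int (k j) * x j)))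
      \<in> borel_measurable (cubeM d)"
    by measurable
  then show ?thesis
    unfolding emode_def[abs_def] cis_conv_exp by measurable
qed

text \<open>For nonzero \<open>m\<close> the antiderivative is again 1-periodic, so the fundamental
  theorem of calculus gives equal values at both endpoints.\<close>

lemma integral_cube1_cis:
  fixes m :: int
  shows "(\<integral>x. cis (2 * pi * real_of_int m * x) \<partial>cube1) = (if m = 0 then 1 else 0)"
proof (cases "m = 0")
  case True
  then show ?thesis using cube1.prob_space by simp
next
  case False
  define c where "c = 2 * pi * real_of_int m"
  have c: "c \<noteq> 0" using False by (simp add: c_def)
  have "((\<lambda>x. cis (c * x) / (\<i> * of_real c)) has_vector_derivative cis (c * x)) (at x within {0..1})" for x
  proof -
    have "((\<lambda>x. exp (\<i> * of_real c * of_real x) / (\<i> * of_real c)) has_vector_derivative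
       exp (\<i> * of_real c * of_real x)) (at x within {0..1})"
      by (rule has_vector_derivative_real_field) (auto intro!: derivative_eq_intros simp: c)
    then show ?thesis by (simp add: cis_conv_exp mult.assoc)
  qed
  moreover have "continuous_on {0..1} (\<lambda>x. cis (c * x))"
    by (simp add: cis_conv_exp) (intro continuous_intros)
  ultimately have "has_bochner_integral lborel (\<lambda>x. indicator {0..1} x *\<^sub>R cis (c * x))
      (cis (c * 1) / (\<i> * of_real c) - cis (c * 0) / (\<i> * of_real c))"
    by (intro has_bochner_integral_FTC_Icc) auto
  then have "(\<integral>x. indicator {0..1} x *\<^sub>R cis (c * x) \<partial>lborel) =
      cis (c * 1) / (\<i> * of_real c) - cis (c * 0) / (\<i> * of_real c)"
    by (rule has_bochner_integral_integral_eq)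
  also have "cis (c * 1) = 1" unfolding c_def by simp
  finally show ?thesis using False
    by (simp add: cube1_def integral_restrict_space c_def)
qed

lemma integrable_bounded_cubeM:
  fixes f :: "_ \<Rightarrow> 'a::{banach,second_countable_topology}"
  assumes "f \<in> borel_measurable (cubeM d)" "\<And>x. x \<in> space (cubeM d) \<Longrightarrow> norm (f x) \<le> B"
  shows "integrable (cubeM d) f"
  using assms by (intro cubeM.integrable_const_bound[of _ B]) auto

text \<open>The exponential is a product of functions of single coordinates, so the integral factors
  over the product measure.\<close>

lemma integral_emode:
  "(\<integral>x. emode d k x \<partial>cubeM d) = (if \<forall>j\<in>{1..d}. k j = 0 then 1 else 0)"
proof -
  have "(\<integral>x. emode d k x \<partial>cubeM d) =
      (\<Prod>j\<in>{1..d}. \<integral>x. cis (2 * pi * real_of_int (k j) * x) \<partial>cube1)"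
    unfolding emode_prod cubeM_eq
  proof (rule cubes.product_integral_prod)
    fix j
    have "continuous_on UNIV (\<lambda>x. cis (2 * pi * real_of_int (k j) * x))"
      by (simp add: cis_conv_exp) (intro continuous_intros)
    then have "(\<lambda>x. cis (2 * pi * real_of_int (k j) * x)) \<in> borel_measurable cube1"
      by (intro measurable_cube1_borel borel_measurable_continuous_onI)
    then show "integrable cube1 (\<lambda>x. cis (2 * pi * real_of_int (k j) * x))"
      by (rule cube1.integrable_const_bound[of _ 1, rotated]) simp
  qed simp
  also have "\<dots> = (if \<forall>j\<in>{1..d}. k j = 0 then 1 else 0)"
    unfolding integral_cube1_cis by (cases "\<forall>j\<in>{1..d}. k j = 0") (auto intro!: prod.neutral prod_zero)
  finally show ?thesis .
qed

text \<open>Members of \<open>freq d\<close> are extensional; this turns agreement on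
  \<open>{1..d}\<close> into equality.\<close>

lemma emode_orthonormal:
  assumes "k \<in> freq d" "l \<in> freq d"
  shows "(\<integral>x. emode d k x * cnj (emode d l x) \<partial>cubeM d) = (if k = l then 1 else 0)"
proof -
  have "(\<forall>j\<in>{1..d}. k j + - l j = 0) \<longleftrightarrow> k = l"
    using assms by (auto simp: freq_def fun_eq_iff PiE_iff extensional_def)
  then show ?thesis
    by (simp add: cnj_emode emode_mult integral_emode)
qed

section \<open>Square-integrable functions and the error of a trigonometric approximation\<close>

lemma L2D:
  assumes "f \<in> L2 d"
  shows "f \<in> borel_measurable (cubeM d)" "integrable (cubeM d) (\<lambda>x. (cmod (f x))^2)"
  using assms by (auto simp: L2_def)

lemma L2_integrable:
  assumes "f \<in> L2 d"
  shows "integrable (cubeM d) f"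
proof (rule Bochner_Integration.integrable_bound)
  show "integrable (cubeM d) (\<lambda>x. 1 + (cmod (f x))^2)"
    using L2D[OF assms] by simp
  have "cmod z \<le> 1 + (cmod z)^2" for z
    using zero_le_power2[of "cmod z - 1/2"] by (auto simp: power2_eq_square algebra_simps)
  then show "AE x in cubeM d. norm (f x) \<le> norm (1 + (cmod (f x))^2)"
    by (intro AE_I2) (smt (verit) real_norm_def zero_le_power2)
qed (use L2D[OF assms] in auto)

lemma L2_bounded:
  assumes "f \<in> borel_measurable (cubeM d)" "\<And>x. x \<in> space (cubeM d) \<Longrightarrow> cmod (f x) \<le> B"
  shows "f \<in> L2 d"
proof -
  have "norm ((cmod (f x))^2) \<le> B^2" if "x \<in> space (cubeM d)" for x
    using assms(2)[OF that] by (simp add: power_mono)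
  then have "integrable (cubeM d) (\<lambda>x. (cmod (f x))^2)"
    by (intro integrable_bounded_cubeM[where B="B^2"]) (use assms(1) in auto)
  then show ?thesis using assms by (simp add: L2_def)
qed

lemma emode_L2: "emode d k \<in> L2 d"
  by (rule L2_bounded[where B=1]) auto

lemma norm_add_sq_le:
  fixes x y :: "'a::real_normed_vector"
  shows "(norm (x + y))^2 \<le> 2 * (norm x)^2 + 2 * (norm y)^2"
proof -
  have "(norm (x + y))^2 \<le> (norm x + norm y)^2"
    by (simp add: norm_triangle_ineq power_mono)
  also have "\<dots> \<le> 2 * (norm x)^2 + 2 * (norm y)^2"
    using zero_le_power2[of "norm x - norm y"] by (simp add: power2_eq_square algebra_simps)
  finally show ?thesis .
qed

lemma L2_add:
  assumes "f \<in> L2 d" "g \<in> L2 d"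
  shows "(\<lambda>x. f x + g x) \<in> L2 d"
proof -
  note [measurable] = L2D(1)[OF assms(1)] L2D(1)[OF assms(2)]
  have "integrable (cubeM d) (\<lambda>x. (cmod (f x + g x))^2)"
  proof (rule Bochner_Integration.integrable_bound)
    show "integrable (cubeM d) (\<lambda>x. 2 * (cmod (f x))^2 + 2 * (cmod (g x))^2)"
      using L2D(2)[OF assms(1)] L2D(2)[OF assms(2)] by simp
  qed (auto simp: norm_add_sq_le)
  then show ?thesis by (simp add: L2_def)
qed

lemma L2_scale:
  assumes "f \<in> L2 d"
  shows "(\<lambda>x. c * f x) \<in> L2 d"
  using L2D[OF assms] by (simp add: L2_def norm_mult power_mult_distrib)

lemma L2_diff:
  assumes "f \<in> L2 d" "g \<in> L2 d"
  shows "(\<lambda>x. f x - g x) \<in> L2 d"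
  using L2_add[OF assms(1) L2_scale[OF assms(2), of "-1"]] by simp

lemma L2_sum:
  assumes "\<And>k. k \<in> F \<Longrightarrow> f k \<in> L2 d"
  shows "(\<lambda>x. \<Sum>k\<in>F. f k x) \<in> L2 d"
  using assms
proof (induction F rule: infinite_finite_induct)
  case (insert k F)
  then show ?case using L2_add[of "f k" d "\<lambda>x. \<Sum>k\<in>F. f k x"] by simp
qed (auto intro: L2_bounded[where B=0])

lemma L2_trig: "(\<lambda>x. \<Sum>k\<in>F. c k * emode d k x) \<in> L2 d"
  by (intro L2_sum L2_scale emode_L2)

lemma L2_times_cnj_emode:
  assumes "f \<in> L2 d"
  shows "integrable (cubeM d) (\<lambda>x. f x * cnj (emode d k x))"
  by (rule Bochner_Integration.integrable_bound[OF L2_integrable[OF assms]])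
     (use L2D[OF assms] in \<open>auto simp: norm_mult cnj_emode\<close>)

lemma fourier_lincomb:
  assumes "f \<in> L2 d" "g \<in> L2 d"
  shows "fourier d (\<lambda>x. \<alpha> * f x + \<beta> * g x) k = \<alpha> * fourier d f k + \<beta> * fourier d g k"
  using L2_times_cnj_emode[OF assms(1), of k] L2_times_cnj_emode[OF assms(2), of k]
  by (simp add: fourier_eq distrib_right mult.assoc)

lemma fourier_trig:
  assumes "finite F" "F \<subseteq> freq d" "l \<in> freq d"
  shows "fourier d (\<lambda>x. \<Sum>k\<in>F. c k * emode d k x) l = (if l \<in> F then c l else 0)"
proof -
  have "fourier d (\<lambda>x. \<Sum>k\<in>F. c k * emode d k x) l =
      (\<integral>x. (\<Sum>k\<in>F. c k * (emode d k x * cnj (emode d l x))) \<partial>cubeM d)"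
    by (simp add: fourier_eq sum_distrib_right mult.assoc)
  also have "\<dots> = (\<Sum>k\<in>F. c k * (\<integral>x. emode d k x * cnj (emode d l x) \<partial>cubeM d))"
    using L2_times_cnj_emode[OF emode_L2] by (subst Bochner_Integration.integral_sum) auto
  also have "\<dots> = (\<Sum>k\<in>F. if k = l then c l else 0)"
    using assms by (intro sum.cong refl) (auto simp: emode_orthonormal)
  finally show ?thesis using assms by simp
qed

text \<open>Expand the square and complete it in the coefficients. With \<open>c\<close> equal to
  the Fourier coefficients the last sum vanishes, which gives the error of a partial sum; with
  general \<open>c\<close> that sum is nonnegative, so any trigonometric approximation on
  \<open>F\<close> bounds the Bessel defect of \<open>F\<close>.\<close>

lemma integral_residual:
  assumes f: "f \<in> L2 d" and F: "finite F" "F \<subseteq> freq d"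
  shows "(\<integral>x. (cmod (f x - (\<Sum>k\<in>F. c k * emode d k x)))^2 \<partial>cubeM d) =
    (\<integral>x. (cmod (f x))^2 \<partial>cubeM d) - (\<Sum>k\<in>F. (cmod (fourier d f k))^2)
      + (\<Sum>k\<in>F. (cmod (fourier d f k - c k))^2)"
proof -
  define u where "u x = (\<Sum>k\<in>F. c k * emode d k x)" for x
  have u: "u \<in> L2 d" unfolding u_def by (rule L2_trig)
  have pt: "(cmod (f x - u x))^2 = (cmod (f x))^2
      - 2 * Re (\<Sum>k\<in>F. cnj (c k) * (f x * cnj (emode d k x)))
      + Re (\<Sum>k\<in>F. cnj (c k) * (u x * cnj (emode d k x)))" for x
  proof -
    have 1: "(\<Sum>k\<in>F. cnj (c k) * (z * cnj (emode d k x))) = z * cnj (u x)" for z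
      by (simp add: u_def sum_distrib_left mult_ac)
    have "(cmod (f x - u x))^2 = (cmod (f x))^2 - 2 * Re (f x * cnj (u x)) + Re (u x * cnj (u x))"
      unfolding cmod_power2 by (simp add: power2_eq_square algebra_simps)
    then show ?thesis unfolding 1 .
  qed
  define A where "A g x = (\<Sum>k\<in>F. cnj (c k) * (g x * cnj (emode d k x)))" for g :: "_ \<Rightarrow> complex" and x
  have A: "integrable (cubeM d) (A g)"
    "(\<integral>x. A g x \<partial>cubeM d) = (\<Sum>k\<in>F. cnj (c k) * fourier d g k)" if "g \<in> L2 d" for g
    unfolding A_def fourier_eq using L2_times_cnj_emode[OF that]
    by (simp_all add: Bochner_Integration.integral_sum)
  have "(\<integral>x. (cmod (f x - u x))^2 \<partial>cubeM d) =
      (\<integral>x. (cmod (f x))^2 - 2 * Re (A f x) + Re (A u x) \<partial>cubeM d)"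
    unfolding pt A_def ..
  also have "\<dots> = (\<integral>x. (cmod (f x))^2 \<partial>cubeM d)
      - 2 * Re (\<integral>x. A f x \<partial>cubeM d) + Re (\<integral>x. A u x \<partial>cubeM d)"
    using L2D(2)[OF f] A(1)[OF f] A(1)[OF u] by simp
  also have "(\<integral>x. A u x \<partial>cubeM d) = (\<Sum>k\<in>F. cnj (c k) * c k)"
    unfolding A(2)[OF u] using F
    by (intro sum.cong refl) (simp add: u_def[abs_def] fourier_trig subset_iff)
  also have "(\<integral>x. A f x \<partial>cubeM d) = (\<Sum>k\<in>F. cnj (c k) * fourier d f k)"
    by (rule A(2)[OF f])
  finally have "(\<integral>x. (cmod (f x - u x))^2 \<partial>cubeM d) = (\<integral>x. (cmod (f x))^2 \<partial>cubeM d)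
      - 2 * (\<Sum>k\<in>F. Re (cnj (c k) * fourier d f k)) + (\<Sum>k\<in>F. Re (cnj (c k) * c k))"
    by simp
  moreover have "(\<Sum>k\<in>F. (cmod (fourier d f k - c k))^2) = (\<Sum>k\<in>F. (cmod (fourier d f k))^2
      - 2 * Re (cnj (c k) * fourier d f k) + Re (cnj (c k) * c k))"
    unfolding cmod_power2 by (intro sum.cong refl) (simp add: power2_eq_square algebra_simps)
  ultimately show ?thesis
    unfolding u_def by (simp add: sum.distrib sum_subtractf sum_distrib_left)
qed

text \<open>Generation by closure rules makes stability under products a short nested induction; the
  form with explicit coefficients is recovered in \<open>trig_explicit\<close>, where the residual
  identity needs it.\<close>

inductive_set trig :: "nat \<Rightarrow> ((nat \<Rightarrow> real) \<Rightarrow> complex) set" for d where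
  trig_emode: "emode d k \<in> trig d"
| trig_add: "p \<in> trig d \<Longrightarrow> q \<in> trig d \<Longrightarrow> (\<lambda>x. p x + q x) \<in> trig d"
| trig_scale: "p \<in> trig d \<Longrightarrow> (\<lambda>x. c * p x) \<in> trig d"

lemma trig_const: "(\<lambda>x. c) \<in> trig d"
  using trig_scale[OF trig_emode[of d "\<lambda>_. 0"], of c] by (simp add: emode_def)

lemma trig_mult:
  assumes "p \<in> trig d" "q \<in> trig d"
  shows "(\<lambda>x. p x * q x) \<in> trig d"
  using assms(1)
proof induction
  case (trig_emode k)
  show ?case using assms(2)
  proof induction
    case (trig_emode l)
    then show ?case by (simp add: emode_mult trig.trig_emode)
  next
    case (trig_add p q)
    then show ?case by (simp add: distrib_left trig.trig_add)
  next
    case (trig_scale p c)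
    then show ?case using trig.trig_scale[of _ d c] by (simp add: mult.left_commute)
  qed
next
  case (trig_add p q)
  then show ?case by (simp add: distrib_right trig.trig_add)
next
  case (trig_scale p c)
  then show ?case using trig.trig_scale[of _ d c] by (simp add: mult.assoc)
qed

lemma trig_prod: "(\<And>i. i \<in> I \<Longrightarrow> p i \<in> trig d) \<Longrightarrow> (\<lambda>x. \<Prod>i\<in>I. p i x) \<in> trig d"
  by (induction I rule: infinite_finite_induct) (auto intro: trig_const trig_mult)

lemma trig_explicit:
  assumes "p \<in> trig d"
  shows "\<exists>F c. finite F \<and> F \<subseteq> freq d \<and> p = (\<lambda>x. \<Sum>k\<in>F. c k * emode d k x)"
  using assms
proof induction
  case (trig_emode k)
  have "restrict k {1..d} \<in> freq d" by (simp add: freq_def)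
  moreover have "emode d k = (\<lambda>x. \<Sum>l\<in>{restrict k {1..d}}. 1 * emode d l x)"
    using emode_restrict[of d k] by simp
  ultimately show ?case
    by (intro exI[of _ "{restrict k {1..d}}"] exI[of _ "\<lambda>_. 1"] conjI) (blast | assumption)+
next
  case (trig_add p q)
  then obtain F c G e where F: "finite F" "F \<subseteq> freq d" "p = (\<lambda>x. \<Sum>k\<in>F. c k * emode d k x)"
    and G: "finite G" "G \<subseteq> freq d" "q = (\<lambda>x. \<Sum>k\<in>G. e k * emode d k x)" by blast
  define c' e' where "c' k = (if k \<in> F then c k else 0)" and "e' k = (if k \<in> G then e k else 0)" for k
  have "p x = (\<Sum>k\<in>F \<union> G. c' k * emode d k x)" for x
    unfolding F(3) by (rule sum.mono_neutral_cong_left) (use F G in \<open>auto simp: c'_def\<close>)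
  moreover have "q x = (\<Sum>k\<in>F \<union> G. e' k * emode d k x)" for x
    unfolding G(3) by (rule sum.mono_neutral_cong_left) (use F G in \<open>auto simp: e'_def\<close>)
  ultimately show ?case
    using F G by (intro exI[of _ "F \<union> G"] exI[of _ "\<lambda>k. c' k + e' k"])
      (auto simp: distrib_right sum.distrib)
next
  case (trig_scale p e)
  then obtain F c where F: "finite F" "F \<subseteq> freq d" "p = (\<lambda>x. \<Sum>k\<in>F. c k * emode d k x)" by blast
  then show ?case
    by (intro exI[of _ F] exI[of _ "\<lambda>k. e * c k"]) (auto simp: sum_distrib_left mult.assoc)
qed

lemma trig_L2: "p \<in> trig d \<Longrightarrow> p \<in> L2 d"
  by (induction rule: trig.induct) (auto intro: emode_L2 L2_add L2_scale)

text \<open>Stone--Weierstrass supplies polynomials in the real-linear functionals of the plane. On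
  the circle such a functional is a combination of \<open>z\<close> and its conjugate, that is of
  the frequencies 1 and -1; sums and products stay in \<open>trig d\<close>.\<close>

lemma trig_real_polynomial:
  fixes g :: "complex \<Rightarrow> real"
  assumes "real_polynomial_function g" "i \<in> {1..d}"
  shows "(\<lambda>x. of_real (g (cis (2 * pi * x i)))) \<in> trig d"
  using assms(1)
proof induction
  case (linear g)
  interpret bounded_linear g by fact
  have lin: "g z = Re z * g 1 + Im z * g \<i>" for z
  proof -
    have "z = Re z *\<^sub>R 1 + Im z *\<^sub>R \<i>" by (simp add: complex_eq_iff)
    then show ?thesis by (metis add scaleR real_scaleR_def)
  qed
  define e where "e s = emode d (\<lambda>j. if j = i then s else 0)" for s :: int
  have e: "e s x = cis (2 * pi * (of_int s * x i))" for s x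
  proof -
    have "(\<Sum>j\<in>{1..d}. real_of_int (if j = i then s else 0) * x j) =
        (\<Sum>j\<in>{1..d}. if j = i then real_of_int s * x j else 0)"
      by (intro sum.cong) auto
    then show ?thesis using assms(2) by (simp add: e_def emode_def)
  qed
  have [simp]: "e s \<in> trig d" for s by (simp add: e_def trig_emode)
  \<comment> \<open>These come from inserting \<open>Re z = (z + cnj z) / 2\<close> and
    \<open>Im z = (z - cnj z) / (2 * \<i>)\<close> into \<open>lin\<close>.\<close>
  define C1 C2 where "C1 = of_real (g 1) / 2 - \<i> * of_real (g \<i>) / 2"
    and "C2 = of_real (g 1) / 2 + \<i> * of_real (g \<i>) / 2"
  have "complex_of_real (g (cis (2 * pi * x i))) = C1 * e 1 x + C2 * e (-1) x" for x
    by (subst lin) (simp add: C1_def C2_def e complex_eq_iff field_simps)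
  then show ?case by (simp add: trig_add trig_scale)
next
  case (const c)
  show ?case by (simp add: trig_const)
next
  case (add f g)
  then show ?case by (simp add: trig_add)
next
  case (mult f g)
  then show ?case by (simp add: trig_mult)
qed

section \<open>Density of trigonometric polynomials\<close>

text \<open>
  The truncated distance to the complementary closed arc is continuous on the circle and converges
  to the indicator of the open arc at every point; Stone--Weierstrass makes it polynomial.
\<close>

lemma circle_interval_approx:
  fixes s :: real
  assumes "s \<le> 1"
  shows "\<exists>g :: nat \<Rightarrow> complex \<Rightarrow> real. (\<forall>m. real_polynomial_function (g m)) \<and>
    (\<forall>m x. \<bar>g m (cis (2 * pi * x))\<bar> \<le> 2) \<and>
    (\<forall>x\<in>{0..1}. (\<lambda>m. g m (cis (2 * pi * x))) \<longlonglongrightarrow> (if 0 < x \<and> x < s then 1 else 0))"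
proof -
  \<comment> \<open>The arc contains the common image of 0 and 1, which is why 0 is excluded in the
    limit. The hypothesis \<open>s \<le> 1\<close> makes it nonempty; the distance to an empty set
    would be 0 everywhere.\<close>
  define C where "C = (\<lambda>x. cis (2 * pi * x)) ` {s..1}"
  define F where "F m z = min 1 (real m * infdist z C)" for m z
  have "compact C"
    unfolding C_def by (intro compact_continuous_image) (simp_all add: cis_conv_exp, intro continuous_intros)
  then have C: "closed C" "C \<noteq> {}"
    using assms by (auto simp: C_def compact_imp_closed)
  have F: "F m z \<in> {0..1}" for m z by (simp add: F_def infdist_nonneg)
  have "\<exists>g. real_polynomial_function g \<and> (\<forall>z\<in>sphere 0 1. \<bar>F m z - g z\<bar> < 1 / real (Suc m))" for m
  proof -
    have "continuous_on (sphere 0 1) (F m)"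
      unfolding F_def[abs_def] by (intro continuous_intros)
    then show ?thesis
      using Stone_Weierstrass_real_polynomial_function[of "sphere 0 1" "F m" "1 / real (Suc m)"]
      by (metis compact_sphere of_nat_0_less_iff zero_less_Suc zero_less_divide_1_iff)
  qed
  then obtain g where g: "\<And>m. real_polynomial_function (g m)"
    and gF: "\<And>m z. z \<in> sphere 0 1 \<Longrightarrow> \<bar>F m z - g m z\<bar> < 1 / real (Suc m)"
    by metis
  have sph: "cis t \<in> sphere 0 1" for t by simp
  \<comment> \<open>The values of \<open>F\<close> contribute at most 1, the polynomial error at
    most \<open>1 / Suc m \<le> 1\<close>. A bound uniform in \<open>m\<close> is what domination
    requires.\<close>
  have "\<bar>g m (cis (2 * pi * x))\<bar> \<le> 2" for m x
  proof -
    have "1 / real (Suc m) \<le> 1" by simp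
    then show ?thesis
      using gF[OF sph, of m "2 * pi * x"] F[of m "cis (2 * pi * x)"] by (simp only: atLeastAtMost_iff) linarith
  qed
  moreover have "(\<lambda>m. g m (cis (2 * pi * x))) \<longlonglongrightarrow> (if 0 < x \<and> x < s then 1 else 0)"
    if x: "x \<in> {0..1}" for x
  proof -
    define z where "z = cis (2 * pi * x)"
    have zC: "z \<notin> C \<longleftrightarrow> 0 < x \<and> x < s"
    proof (intro iffI conjI notI)
      assume z: "z \<notin> C"
      then have "x \<notin> {s..1}" unfolding C_def z_def by blast
      then show "x < s" using x by auto
      have "cis (2 * pi * 1) \<in> C" using assms unfolding C_def by (intro imageI) auto
      then have "x \<noteq> 0" using z by (auto simp: z_def)
      then show "0 < x" using x by auto
    next
      assume a: "0 < x \<and> x < s" and "z \<in> C"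
      then obtain y where y: "y \<in> {s..1}" "cis (2 * pi * x) = cis (2 * pi * y)"
        by (auto simp: C_def z_def)
      then have "cis (2 * pi * x - 2 * pi * y) = 1"
        by (simp flip: cis_divide)
      then obtain n where n: "2 * pi * x - 2 * pi * y = of_int n * (2 * pi)"
        using cis_eq_1_iff by blast
      then have "pi * (x - y) = pi * of_int n" by (simp add: algebra_simps)
      then have "x - y = of_int n" by simp
      \<comment> \<open>From \<open>0 < x\<close>, \<open>x < s\<close>, \<open>s \<le> y\<close>
        and \<open>y \<le> 1\<close>, the difference lies strictly between -1 and 0, where there is
        no integer.\<close>
      then have "of_int n < (0::real)" "of_int n > (-1::real)" using a y by auto
      then have "n < 0" "n > -1" by simp_all
      then show False by linarith
    qed
    have "(\<lambda>m. F m z) \<longlonglongrightarrow> (if 0 < x \<and> x < s then 1 else 0)"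
    proof (cases "z \<in> C")
      case True
      then have "\<not> (0 < x \<and> x < s)" using zC by blast
      then show ?thesis using True by (simp only: if_False) (simp add: F_def)
    next
      case False
      then have pos: "infdist z C > 0" using C by (simp add: infdist_pos_not_in_closed)
      obtain N where N: "1 / infdist z C < real N" using reals_Archimedean2 by blast
      have "F m z = 1" if "m \<ge> N" for m
      proof -
        have "1 / infdist z C \<le> real m" using N that by linarith
        then show ?thesis using pos by (simp add: F_def field_simps)
      qed
      then have "eventually (\<lambda>m. F m z = 1) sequentially"
        by (auto simp: eventually_sequentially)
      moreover have "0 < x \<and> x < s" using zC False by blast
      ultimately show ?thesis by (simp add: tendsto_eventually)
    qed
    moreover have "(\<lambda>m. F m z - g m z) \<longlonglongrightarrow> 0"
    proof (rule Lim_null_comparison)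
      show "\<forall>\<^sub>F m in sequentially. norm (F m z - g m z) \<le> 1 / real (Suc m)"
        using gF[OF sph, of _ "2 * pi * x"] by (auto simp: z_def intro!: always_eventually less_imp_le)
      show "(\<lambda>m. 1 / real (Suc m)) \<longlonglongrightarrow> 0"
        using LIMSEQ_inverse_real_of_nat by (simp add: inverse_eq_divide)
    qed
    ultimately have "(\<lambda>m. F m z - (F m z - g m z)) \<longlonglongrightarrow> (if 0 < x \<and> x < s then 1 else 0) - 0"
      by (rule tendsto_diff)
    then show ?thesis by (simp add: z_def)
  qed
  ultimately show ?thesis using g by blast
qed

text \<open>Membership in \<open>L2 d\<close> is included because a non-integrable square has
  Bochner integral 0 and would pass for a perfect approximation.\<close>

definition trig_approx :: "nat \<Rightarrow> ((nat \<Rightarrow> real) \<Rightarrow> complex) \<Rightarrow> bool" where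
  "trig_approx d f \<longleftrightarrow> f \<in> L2 d \<and>
     (\<forall>\<epsilon>>0. \<exists>p\<in>trig d. (\<integral>x. (cmod (f x - p x))^2 \<partial>cubeM d) < \<epsilon>)"

text \<open>The pointwise bound \<open>norm_add_sq_le\<close> yields a triangle inequality for
  squared distances with factor 2, so Minkowski's inequality is avoided. Using it with two terms
  explains the \<open>\<epsilon> / 4\<close> in the closure lemmas.\<close>

lemma L2_dist_triangle:
  assumes "f \<in> L2 d" "g \<in> L2 d" "h \<in> L2 d"
  shows "(\<integral>x. (cmod (f x - h x))^2 \<partial>cubeM d) \<le>
    2 * (\<integral>x. (cmod (f x - g x))^2 \<partial>cubeM d) + 2 * (\<integral>x. (cmod (g x - h x))^2 \<partial>cubeM d)"
proof -
  note I = L2D(2)[OF L2_diff]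
  have "(\<integral>x. (cmod (f x - h x))^2 \<partial>cubeM d) \<le>
      (\<integral>x. 2 * (cmod (f x - g x))^2 + 2 * (cmod (g x - h x))^2 \<partial>cubeM d)"
  proof (rule integral_mono)
    show "(cmod (f x - h x))^2 \<le> 2 * (cmod (f x - g x))^2 + 2 * (cmod (g x - h x))^2" for x
      using norm_add_sq_le[of "f x - g x" "g x - h x"] by simp
  qed (use I assms in auto)
  then show ?thesis using I assms by simp
qed

lemma trig_approx_trig: "p \<in> trig d \<Longrightarrow> trig_approx d p"
  unfolding trig_approx_def by (auto intro!: bexI[of _ p] trig_L2)

lemma trig_approx_closed:
  assumes f: "f \<in> L2 d"
    and "\<And>\<epsilon>. \<epsilon> > 0 \<Longrightarrow> \<exists>g. trig_approx d g \<and> (\<integral>x. (cmod (f x - g x))^2 \<partial>cubeM d) < \<epsilon>"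
  shows "trig_approx d f"
  unfolding trig_approx_def
proof (intro conjI allI impI)
  fix \<epsilon> :: real assume "\<epsilon> > 0"
  then obtain g where g: "trig_approx d g" "(\<integral>x. (cmod (f x - g x))^2 \<partial>cubeM d) < \<epsilon> / 4"
    using assms(2)[of "\<epsilon> / 4"] by auto
  then obtain p where p: "p \<in> trig d" "(\<integral>x. (cmod (g x - p x))^2 \<partial>cubeM d) < \<epsilon> / 4"
    using \<open>\<epsilon> > 0\<close> unfolding trig_approx_def by (meson divide_pos_pos zero_less_numeral)
  have "g \<in> L2 d" using g(1) by (simp add: trig_approx_def)
  then have "(\<integral>x. (cmod (f x - p x))^2 \<partial>cubeM d) < \<epsilon>"
    using L2_dist_triangle[OF f _ trig_L2[OF p(1)], of g] g(2) p(2) by linarith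
  with p show "\<exists>p\<in>trig d. (\<integral>x. (cmod (f x - p x))^2 \<partial>cubeM d) < \<epsilon>" by blast
qed (rule f)

lemma trig_approx_scale:
  assumes "trig_approx d f"
  shows "trig_approx d (\<lambda>x. c * f x)"
proof (cases "c = 0")
  case True
  then show ?thesis using trig_approx_trig[OF trig_const[of 0]] by simp
next
  case False
  show ?thesis
    unfolding trig_approx_def
  proof (intro conjI allI impI)
    fix \<epsilon> :: real assume "\<epsilon> > 0"
    then obtain p where p: "p \<in> trig d" "(\<integral>x. (cmod (f x - p x))^2 \<partial>cubeM d) < \<epsilon> / (cmod c)^2"
      using assms False unfolding trig_approx_def
      by (meson divide_pos_pos zero_less_norm_iff zero_less_power)
    have "cmod (c * f x - c * p x) = cmod c * cmod (f x - p x)" for x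
      by (simp add: right_diff_distrib[symmetric] norm_mult)
    then have "(\<integral>x. (cmod (c * f x - c * p x))^2 \<partial>cubeM d) < \<epsilon>"
      using p(2) False by (simp add: power_mult_distrib field_simps)
    then show "\<exists>p\<in>trig d. (\<integral>x. (cmod (c * f x - p x))^2 \<partial>cubeM d) < \<epsilon>"
      using p(1) by (auto intro!: bexI[of _ "\<lambda>x. c * p x"] trig_scale)
  qed (use assms in \<open>simp add: trig_approx_def L2_scale\<close>)
qed

lemma trig_approx_add:
  assumes "trig_approx d f" "trig_approx d g"
  shows "trig_approx d (\<lambda>x. f x + g x)"
  unfolding trig_approx_def
proof (intro conjI allI impI)
  have L: "f \<in> L2 d" "g \<in> L2 d" using assms by (auto simp: trig_approx_def)
  then show "(\<lambda>x. f x + g x) \<in> L2 d" by (rule L2_add)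
  fix \<epsilon> :: real assume "\<epsilon> > 0"
  then obtain p q where p: "p \<in> trig d" "(\<integral>x. (cmod (f x - p x))^2 \<partial>cubeM d) < \<epsilon> / 4"
    and q: "q \<in> trig d" "(\<integral>x. (cmod (g x - q x))^2 \<partial>cubeM d) < \<epsilon> / 4"
    using assms unfolding trig_approx_def by (meson divide_pos_pos zero_less_numeral)
  have L': "p \<in> L2 d" "q \<in> L2 d" using p q trig_L2 by auto
  have "(\<integral>x. (cmod (f x + g x - (p x + q x)))^2 \<partial>cubeM d) \<le>
      2 * (\<integral>x. (cmod (f x + g x - (p x + g x)))^2 \<partial>cubeM d) +
      2 * (\<integral>x. (cmod (p x + g x - (p x + q x)))^2 \<partial>cubeM d)"
    by (intro L2_dist_triangle L2_add L L')
  then have "(\<integral>x. (cmod (f x + g x - (p x + q x)))^2 \<partial>cubeM d) < \<epsilon>"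
    using p q by simp
  with p(1) q(1) show "\<exists>p\<in>trig d. (\<integral>x. (cmod (f x + g x - p x))^2 \<partial>cubeM d) < \<epsilon>"
    by (auto intro!: bexI[of _ "\<lambda>x. p x + q x"] trig_add)
qed

lemma trig_approx_sum:
  "(\<And>i. i \<in> I \<Longrightarrow> trig_approx d (f i)) \<Longrightarrow> trig_approx d (\<lambda>x. \<Sum>i\<in>I. f i x)"
  by (induction I rule: infinite_finite_induct)
     (auto intro: trig_approx_add trig_approx_trig trig_const)

text \<open>The limit inherits the bound \<open>w\<close>, so the squared differences are dominated
  by \<open>(2 * w)^2\<close> and their integrals tend to 0. Every limit passage in the density
  proof (boxes, disjoint unions, simple functions) goes through this lemma.\<close>

lemma trig_approx_dominated:
  assumes g: "\<And>n. trig_approx d (g n)"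
    and f: "f \<in> borel_measurable (cubeM d)"
    and w: "integrable (cubeM d) (\<lambda>x. (w x)^2)"
    and lim: "AE x in cubeM d. (\<lambda>n. g n x) \<longlonglongrightarrow> f x"
    and bound: "AE x in cubeM d. \<forall>n. cmod (g n x) \<le> w x"
  shows "trig_approx d f"
proof (rule trig_approx_closed)
  note [measurable] = f
  have [measurable]: "g n \<in> borel_measurable (cubeM d)" for n
    using g L2D(1) unfolding trig_approx_def by blast
  have fw: "AE x in cubeM d. cmod (f x) \<le> w x"
    using lim bound
  proof eventually_elim
    fix x assume "(\<lambda>n. g n x) \<longlonglongrightarrow> f x" "\<forall>n. cmod (g n x) \<le> w x"
    then show "cmod (f x) \<le> w x" by (auto intro: LIMSEQ_le_const2 tendsto_norm)
  qed
  have "integrable (cubeM d) (\<lambda>x. (cmod (f x))^2)"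
  proof (rule Bochner_Integration.integrable_bound[OF w])
    show "AE x in cubeM d. norm ((cmod (f x))^2) \<le> norm ((w x)^2)"
      using fw by eventually_elim (simp add: power_mono)
  qed measurable
  then show "f \<in> L2 d" using f by (simp add: L2_def)
  have "(\<lambda>n. \<integral>x. (cmod (f x - g n x))^2 \<partial>cubeM d) \<longlonglongrightarrow> (\<integral>x. 0 \<partial>cubeM d)"
  proof (rule integral_dominated_convergence)
    show "integrable (cubeM d) (\<lambda>x. 4 * (w x)^2)" using w by simp
    show "AE x in cubeM d. (\<lambda>n. (cmod (f x - g n x))^2) \<longlonglongrightarrow> 0"
      using lim
    proof eventually_elim
      fix x assume "(\<lambda>n. g n x) \<longlonglongrightarrow> f x"
      then have "(\<lambda>n. (cmod (f x - g n x))^2) \<longlonglongrightarrow> (cmod (f x - f x))^2"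
        by (intro tendsto_intros)
      then show "(\<lambda>n. (cmod (f x - g n x))^2) \<longlonglongrightarrow> 0" by simp
    qed
    show "AE x in cubeM d. norm ((cmod (f x - g n x))^2) \<le> 4 * (w x)^2" for n
      using fw bound
    proof eventually_elim
      fix x assume "cmod (f x) \<le> w x" "\<forall>n. cmod (g n x) \<le> w x"
      then have "cmod (f x - g n x) \<le> 2 * w x"
        by (smt (verit) norm_triangle_ineq4)
      then have "(cmod (f x - g n x))^2 \<le> (2 * w x)^2" by (intro power_mono) auto
      then show "norm ((cmod (f x - g n x))^2) \<le> 4 * (w x)^2" by simp
    qed
  qed measurable
  then have lim0: "(\<lambda>n. \<integral>x. (cmod (f x - g n x))^2 \<partial>cubeM d) \<longlonglongrightarrow> 0" by simp
  fix \<epsilon> :: real assume "\<epsilon> > 0"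
  then have "eventually (\<lambda>n. (\<integral>x. (cmod (f x - g n x))^2 \<partial>cubeM d) < \<epsilon>) sequentially"
    using lim0 by (rule order_tendstoD(2)[rotated])
  then show "\<exists>g. trig_approx d g \<and> (\<integral>x. (cmod (f x - g x))^2 \<partial>cubeM d) < \<epsilon>"
    using g by (meson eventually_happens' sequentially_bot)
qed

text \<open>Being intersection-stable generators, these boxes suffice for a Dynkin-system argument.\<close>

definition corner_box :: "nat \<Rightarrow> (nat \<Rightarrow> real) \<Rightarrow> (nat \<Rightarrow> real) set" where
  "corner_box d s = {x \<in> space (cubeM d). \<forall>j\<in>{1..d}. x j \<le> s j}"

lemma sets_cubeM_corner_boxes:
  assumes "d \<ge> 1"
  shows "sets (cubeM d) = sigma_sets (space (cubeM d)) (range (corner_box d))"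
proof -
  define E where "E = (\<inter>) {0..1} ` range (\<lambda>s::real. {..s})"
  have borel: "sets (borel :: real measure) = sigma_sets UNIV (range (\<lambda>s::real. {..s}))"
    by (subst borel_eq_atMost) simp
  have "sets cube1 = (\<inter>) {0..1} ` sigma_sets UNIV (range (\<lambda>s::real. {..s}))"
    by (simp add: sets_cube1 sets_restrict_space borel)
  also have "\<dots> = sigma_sets {0..1} E"
    unfolding E_def
    by (rule sigma_sets_Int) (auto simp flip: borel)
  also have "\<dots> = sets (sigma {0..1} E)"
    by (simp add: E_def sets_measure_of_conv image_subset_iff)
  finally have c1: "sets cube1 = sets (sigma {0..1} E)" .
  have "sets (cubeM d) = sets (PiM {1..d} (\<lambda>_. sigma {0..1} E))"
    unfolding cubeM_eq by (intro sets_PiM_cong refl c1)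
  \<comment> \<open>With the single index block \<open>{1..d}\<close> every generator constrains all
    coordinates at once, so the generators are exactly the corner boxes.\<close>
  also have "\<dots> = sets (sigma (PiE {1..d} (\<lambda>_. {0..1}))
      {{f\<in>PiE {1..d} (\<lambda>_. {0..1}). \<forall>i\<in>j. f i \<in> A i} |A j. j \<in> {{1..d}} \<and> A \<in> Pi j (\<lambda>_. E)})"
  proof (rule sets_PiM_sigma)
    fix i
    \<comment> \<open>The ray ending at 1 cuts out the whole interval, so one generator already
      covers the space.\<close>
    have "{0..1} \<in> E" by (auto simp: E_def intro!: image_eqI[of _ _ "{..1}"])
    then show "\<exists>S\<subseteq>E. countable S \<and> {0..1} = \<Union>S"
      by (intro exI[of _ "{{0..1}}"]) auto
  qed (auto simp: E_def)
  also have "{{f\<in>PiE {1..d} (\<lambda>_. {0..1}). \<forall>i\<in>j. f i \<in> A i} |A j. j \<in> {{1..d}} \<and> A \<in> Pi j (\<lambda>_. E)}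
      = range (corner_box d)" (is "?P = _")
  proof (intro equalityI subsetI)
    fix B assume "B \<in> ?P"
    then obtain A where A: "A \<in> {1..d} \<rightarrow> E" "B = {f\<in>PiE {1..d} (\<lambda>_. {0..1}). \<forall>i\<in>{1..d}. f i \<in> A i}"
      by auto
    have "\<forall>i\<in>{1..d}. \<exists>s. A i = {0..1} \<inter> {..s}" using A(1) unfolding E_def by blast
    then obtain s where "\<forall>i\<in>{1..d}. A i = {0..1} \<inter> {..s i}" by metis
    then have "B = corner_box d s"
      unfolding A(2) corner_box_def space_cubeM by (auto simp: PiE_iff)
    then show "B \<in> range (corner_box d)" by blast
  next
    fix B assume "B \<in> range (corner_box d)"
    then obtain s where "B = corner_box d s" by blast
    then have "B = {f\<in>PiE {1..d} (\<lambda>_. {0..1}). \<forall>i\<in>{1..d}. f i \<in> {0..1} \<inter> {..s i}}"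
      by (auto simp: corner_box_def space_cubeM PiE_iff)
    moreover have "(\<lambda>i. {0..1} \<inter> {..s i}) \<in> {1..d} \<rightarrow> E"
      unfolding E_def by blast
    ultimately show "B \<in> ?P"
      by (intro CollectI exI[of _ "\<lambda>i. {0..1} \<inter> {..s i}"] exI[of _ "{1..d}"] conjI)
         (assumption | rule singletonI)+
  qed
  also have "sets (sigma (PiE {1..d} (\<lambda>_. {0..1})) (range (corner_box d))) =
      sigma_sets (space (cubeM d)) (range (corner_box d))"
    unfolding space_cubeM[symmetric] by (rule sets_measure_of) (auto simp: corner_box_def)
  finally show ?thesis .
qed

text \<open>Discards the hyperplanes on which the limit of the circle polynomials may differ from
  the indicator of a box.\<close>

lemma AE_component_neq: "j \<in> {1..d} \<Longrightarrow> AE x in cubeM d. x j \<noteq> (c::real)"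
  unfolding cubeM_eq
proof (rule AE_PiM_component[where P="\<lambda>y. y \<noteq> c"])
  have "AE x in lborel. x \<noteq> c" by (rule AE_lborel_singleton)
  then show "AE x in cube1. x \<noteq> c"
    unfolding cube1_def by (subst AE_restrict_space_iff) auto
qed (auto intro: prob_space_cube1)

lemma trig_approx_corner_box:
  "trig_approx d (indicator (corner_box d s))"
proof -
  \<comment> \<open>\<open>circle_interval_approx\<close> needs an endpoint at most 1; on the cube
    the truncation does not change the box.\<close>
  define t where "t j = min (s j) 1" for j
  have "\<exists>g :: nat \<Rightarrow> complex \<Rightarrow> real. (\<forall>m. real_polynomial_function (g m)) \<and>
    (\<forall>m x. \<bar>g m (cis (2 * pi * x))\<bar> \<le> 2) \<and>
    (\<forall>x\<in>{0..1}. (\<lambda>m. g m (cis (2 * pi * x))) \<longlonglongrightarrow> (if 0 < x \<and> x < t j then 1 else 0))" for j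
    by (rule circle_interval_approx) (simp add: t_def)
  then obtain g :: "nat \<Rightarrow> nat \<Rightarrow> complex \<Rightarrow> real" where
    g: "\<And>j m. real_polynomial_function (g j m)" "\<And>j m x. \<bar>g j m (cis (2 * pi * x))\<bar> \<le> 2"
    "\<And>j x. x \<in> {0..1} \<Longrightarrow> (\<lambda>m. g j m (cis (2 * pi * x))) \<longlonglongrightarrow> (if 0 < x \<and> x < t j then 1 else 0)"
    by metis
  define p where "p m x = (\<Prod>j\<in>{1..d}. complex_of_real (g j m (cis (2 * pi * x j))))" for m x
  have p: "p m \<in> trig d" for m
    unfolding p_def by (intro trig_prod trig_real_polynomial g)
  show ?thesis
  proof (rule trig_approx_dominated)
    show "trig_approx d (p n)" for n using p by (rule trig_approx_trig)
    show "integrable (cubeM d) (\<lambda>x. (2 ^ d)^2)" by simp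
    have "cmod (p n x) \<le> 2 ^ d" for n x
    proof -
      have "cmod (p n x) \<le> (\<Prod>j\<in>{1..d}. 2)"
        unfolding p_def prod_norm[symmetric] using g(2) by (intro prod_mono) auto
      then show ?thesis by simp
    qed
    then show "AE x in cubeM d. \<forall>n. cmod (p n x) \<le> 2 ^ d" by simp
    \<comment> \<open>Off these faces the open condition \<open>0 < x j \<and> x j < t j\<close>
      coincides with \<open>x j \<le> s j\<close>.\<close>
    have "AE x in cubeM d. \<forall>j\<in>{1..d}. x j \<noteq> 0 \<and> x j \<noteq> t j"
      by (intro AE_ball_countable[THEN iffD2] ballI AE_conjI AE_component_neq) auto
    then show "AE x in cubeM d. (\<lambda>n. p n x) \<longlonglongrightarrow> indicator (corner_box d s) x"
      using AE_space
    proof eventually_elim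
      fix x assume ne: "\<forall>j\<in>{1..d}. x j \<noteq> 0 \<and> x j \<noteq> t j" and sp: "x \<in> space (cubeM d)"
      then have x01: "x j \<in> {0..1}" if "j \<in> {1..d}" for j using that by (auto simp: space_cubeM PiE_iff)
      have iff: "(0 < x j \<and> x j < t j) \<longleftrightarrow> x j \<le> s j" if "j \<in> {1..d}" for j
        using x01[OF that] ne that by (auto simp: t_def less_le)
      have "(\<lambda>n. p n x) \<longlonglongrightarrow> (\<Prod>j\<in>{1..d}. complex_of_real (if 0 < x j \<and> x j < t j then 1 else 0))"
        unfolding p_def by (intro tendsto_prod tendsto_of_real g(3) x01)
      also have "(\<Prod>j\<in>{1..d}. complex_of_real (if 0 < x j \<and> x j < t j then 1 else 0)) =
          (\<Prod>j\<in>{1..d}. if x j \<le> s j then 1 else 0)"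
        using iff by (intro prod.cong) auto
      also have "\<dots> = indicator (corner_box d s) x"
      proof (cases "\<forall>j\<in>{1..d}. x j \<le> s j")
        case True
        then have "x \<in> corner_box d s" using sp by (simp add: corner_box_def)
        then show ?thesis using True by simp
      next
        case False
        then have "x \<notin> corner_box d s" by (auto simp: corner_box_def)
        moreover have "(\<Prod>j\<in>{1..d}. if x j \<le> s j then 1 else 0::complex) = 0"
          using False by (intro prod_zero) auto
        ultimately show ?thesis by simp
      qed
      finally show "(\<lambda>n. p n x) \<longlonglongrightarrow> indicator (corner_box d s) x" .
    qed
    have "corner_box d s \<in> sets (cubeM d)"
      unfolding corner_box_def
      by (rule sets.sets_Collect_finite_All)
         (rule borel_measurable_le[OF measurable_component_cubeM borel_measurable_const], simp_all)
    then show "indicator (corner_box d s) \<in> borel_measurable (cubeM d)" by simp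
  qed
qed

lemma trig_approx_indicator:
  assumes "d \<ge> 1" "A \<in> sets (cubeM d)"
  shows "trig_approx d (indicator A)"
proof -
  have "Int_stable (range (corner_box d))"
  proof (rule Int_stableI)
    fix A B assume "A \<in> range (corner_box d)" "B \<in> range (corner_box d)"
    then obtain s t where "A = corner_box d s" "B = corner_box d t" by blast
    then have "A \<inter> B = corner_box d (\<lambda>j. min (s j) (t j))" by (auto simp: corner_box_def)
    then show "A \<inter> B \<in> range (corner_box d)" by blast
  qed
  moreover have "range (corner_box d) \<subseteq> Pow (space (cubeM d))" by (auto simp: corner_box_def)
  moreover note sg = sets_cubeM_corner_boxes[OF assms(1)]
  have "A \<in> sigma_sets (space (cubeM d)) (range (corner_box d))" using assms sg by simp
  ultimately show ?thesis
  proof (induction rule: sigma_sets_induct_disjoint)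
    case (basic A)
    then show ?case using trig_approx_corner_box by auto
  next
    case empty
    then show ?case using trig_approx_trig[OF trig_const[of 0]] by (simp add: indicator_def[abs_def])
  next
    case (compl A)
    \<comment> \<open>Outside the cube this function is 1 while the indicator of the relative
      complement is 0. The two agree only on the space, so a constant sequence in
      \<open>trig_approx_dominated\<close> is used to pass from one to the other.\<close>
    have lin: "trig_approx d (\<lambda>x. 1 + (-1) * indicator A x)"
      by (rule trig_approx_add[OF trig_approx_trig[OF trig_const] trig_approx_scale[OF compl(2)]])
    show ?case
    proof (rule trig_approx_dominated[where w="\<lambda>_. 1"])
      show "trig_approx d (\<lambda>x. 1 + (-1) * indicator A x)" for n :: nat by (rule lin)
      show "indicator (space (cubeM d) - A) \<in> borel_measurable (cubeM d)"
        by (intro borel_measurable_indicator sets.Diff sets.top) (simp only: sg compl(1))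
      show "AE x in cubeM d. (\<lambda>n. 1 + (-1) * indicator A x)
          \<longlonglongrightarrow> (indicator (space (cubeM d) - A) x :: complex)"
        by (intro AE_I2) (simp add: indicator_def)
      show "AE x in cubeM d. \<forall>n::nat. cmod (1 + (-1) * indicator A x) \<le> 1"
        by (intro AE_I2) (simp add: indicator_def)
    qed simp
  next
    case (union A)
    show ?case
    proof (rule trig_approx_dominated[where g="\<lambda>n x. \<Sum>i<n. indicator (A i) x" and w="\<lambda>_. 1"])
      have lim: "(\<lambda>n. \<Sum>i<n. indicator (A i) x) \<longlonglongrightarrow> (indicator (\<Union>i. A i) x :: complex)" for x
      proof -
        have "complex_of_real (indicator B x) = indicator B x" for B by (simp add: indicator_def)
        then have "(\<lambda>i. indicator (A i) x) sums (indicator (\<Union>i. A i) x :: complex)"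
          using sums_of_real[OF indicator_sums[of A x], where 'a=complex] union(1)
          by (simp add: disjoint_family_on_def)
        then show ?thesis by (simp add: sums_def)
      qed
      then show "AE x in cubeM d. (\<lambda>n. \<Sum>i<n. indicator (A i) x) \<longlonglongrightarrow> (indicator (\<Union>i. A i) x :: complex)"
        by simp
      \<comment> \<open>Disjointness makes each partial sum the indicator of a finite union, which
        provides the majorant 1.\<close>
      have "cmod (\<Sum>i<n. indicator (A i) x) \<le> 1" for n x
      proof -
        have "disjoint_family_on A {..<n}" using union(1) by (auto simp: disjoint_family_on_def)
        then have "(\<Sum>i<n. indicator (A i) x) = (indicator (\<Union>i<n. A i) x :: complex)"
          by (subst indicator_UN_disjoint) auto
        then show ?thesis by (simp add: indicator_def)
      qed
      then show "AE x in cubeM d. \<forall>n. cmod (\<Sum>i<n. indicator (A i) x) \<le> 1" by simp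
      have "(\<Union>i. A i) \<in> sets (cubeM d)"
        unfolding sg using union(2) by (intro sigma_sets.Union) blast
      then show "indicator (\<Union>i. A i) \<in> borel_measurable (cubeM d)" by simp
    qed (auto intro: trig_approx_sum union)
  qed
qed

text \<open>Simple functions \<open>F i\<close> converge to \<open>f\<close> pointwise with
  \<open>cmod (F i x) \<le> 2 * cmod (f x)\<close>. Each agrees on the cube with a finite
  combination of indicators of its level sets, and \<open>2 * cmod (f x)\<close> is a
  square-integrable majorant.\<close>

lemma trig_approx_L2:
  assumes "d \<ge> 1" "f \<in> L2 d"
  shows "trig_approx d f"
proof -
  note [measurable] = L2D(1)[OF assms(2)]
  from borel_measurable_implies_sequence_metric[OF L2D(1)[OF assms(2)], of 0]
  obtain F where "(\<forall>i. simple_function (cubeM d) (F i)) \<and>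
      (\<forall>x\<in>space (cubeM d). (\<lambda>i. F i x) \<longlonglongrightarrow> f x) \<and>
      (\<forall>i. \<forall>x\<in>space (cubeM d). dist (F i x) 0 \<le> 2 * dist (f x) 0)"
    by (rule exE)
  then have F: "\<And>i. simple_function (cubeM d) (F i)"
    "\<And>x. x \<in> space (cubeM d) \<Longrightarrow> (\<lambda>i. F i x) \<longlonglongrightarrow> f x"
    "\<And>i x. x \<in> space (cubeM d) \<Longrightarrow> cmod (F i x) \<le> 2 * cmod (f x)"
    by auto
  have Fi: "trig_approx d (\<lambda>x. \<Sum>y\<in>F i ` space (cubeM d). y * indicator (F i -` {y} \<inter> space (cubeM d)) x)" for i
    by (intro trig_approx_sum trig_approx_scale trig_approx_indicator assms(1) simple_functionD(2) F(1))
  have eq: "(\<Sum>y\<in>F i ` space (cubeM d). y * indicator (F i -` {y} \<inter> space (cubeM d)) x) = F i x"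
    if "x \<in> space (cubeM d)" for i x
  proof -
    have "(\<Sum>y\<in>F i ` space (cubeM d). y * indicator (F i -` {y} \<inter> space (cubeM d)) x) =
        (\<Sum>y\<in>F i ` space (cubeM d). if y = F i x then y else 0)"
      using that by (intro sum.cong) (auto simp: indicator_def)
    then show ?thesis using that simple_functionD(1)[OF F(1)[of i]] by simp
  qed
  show ?thesis
  proof (rule trig_approx_dominated)
    show "trig_approx d (\<lambda>x. \<Sum>y\<in>F i ` space (cubeM d). y * indicator (F i -` {y} \<inter> space (cubeM d)) x)" for i
      by (rule Fi)
    show "integrable (cubeM d) (\<lambda>x. (2 * cmod (f x))^2)"
      using L2D(2)[OF assms(2)] by (simp add: power_mult_distrib)
    show "AE x in cubeM d. (\<lambda>i. \<Sum>y\<in>F i ` space (cubeM d). y * indicator (F i -` {y} \<inter> space (cubeM d)) x)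
        \<longlonglongrightarrow> f x"
      by (intro AE_I2) (simp add: eq F(2))
    show "AE x in cubeM d. \<forall>i. cmod (\<Sum>y\<in>F i ` space (cubeM d). y * indicator (F i -` {y} \<inter> space (cubeM d)) x)
        \<le> 2 * cmod (f x)"
      by (intro AE_I2) (simp add: eq F(3))
  qed measurable
qed

section \<open>Approximation numbers of a diagonal embedding\<close>

text \<open>Gaussian elimination, by induction on the equations \<open>G\<close>; the members of
  \<open>M\<close> index the unknowns. An equation with zero coefficients is dropped, any other one
  is solved for an unknown \<open>q\<close>, which lowers both counts by one.\<close>

lemma homogeneous_system_nontrivial:
  fixes m :: "'k \<Rightarrow> 'g \<Rightarrow> 'f::field"
  assumes "finite G" "finite M" "card G < card M"
  shows "\<exists>c. (\<exists>k\<in>M. c k \<noteq> 0) \<and> (\<forall>g\<in>G. (\<Sum>k\<in>M. c k * m k g) = 0)"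
  using assms
proof (induction G arbitrary: M m rule: finite_induct)
  case empty
  then obtain k where "k \<in> M" by (auto simp: card_gt_0_iff)
  then show ?case by (intro exI[of _ "\<lambda>_. 1"]) auto
next
  case (insert g G)
  show ?case
  proof (cases "\<forall>k\<in>M. m k g = 0")
    case True
    obtain c where c: "\<exists>k\<in>M. c k \<noteq> 0" "\<forall>h\<in>G. (\<Sum>k\<in>M. c k * m k h) = 0"
      using insert.IH[of M m] insert.prems insert.hyps by auto
    have "(\<Sum>k\<in>M. c k * m k g) = 0" using True by (intro sum.neutral) auto
    with c show ?thesis by auto
  next
    case False
    then obtain q where q: "q \<in> M" "m q g \<noteq> 0" by blast
    \<comment> \<open>The coefficients left after subtracting the multiple of equation
      \<open>g\<close> that cancels the unknown \<open>q\<close>.\<close>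
    define m' where "m' k h = m k h - m k g / m q g * m q h" for k h
    have "card G < card (M - {q})" using insert q by simp
    then obtain c where c: "\<exists>k\<in>M - {q}. c k \<noteq> 0" "\<forall>h\<in>G. (\<Sum>k\<in>M - {q}. c k * m' k h) = 0"
      using insert.IH[of "M - {q}" m'] insert.prems by auto
    \<comment> \<open>Back substitution: the value at \<open>q\<close> is forced by equation
      \<open>g\<close>.\<close>
    define e where "e k = (if k = q then - (\<Sum>k\<in>M - {q}. c k * m k g) / m q g else c k)" for k
    have split: "(\<Sum>k\<in>M. e k * m k h) = e q * m q h + (\<Sum>k\<in>M - {q}. c k * m k h)" for h
    proof -
      have "(\<Sum>k\<in>M. e k * m k h) = e q * m q h + (\<Sum>k\<in>M - {q}. e k * m k h)"
        using q insert.prems by (simp add: sum.remove)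
      also have "(\<Sum>k\<in>M - {q}. e k * m k h) = (\<Sum>k\<in>M - {q}. c k * m k h)"
        by (intro sum.cong) (auto simp: e_def)
      finally show ?thesis .
    qed
    have "(\<Sum>k\<in>M. e k * m k h) = (\<Sum>k\<in>M - {q}. c k * m' k h)" for h
      unfolding split m'_def right_diff_distrib sum_subtractf
      by (simp add: e_def sum_distrib_right sum_divide_distrib mult.assoc)
    moreover have "(\<Sum>k\<in>M. e k * m k g) = 0"
      unfolding split using q by (simp add: e_def)
    moreover have "\<exists>k\<in>M. e k \<noteq> 0" using c(1) by (auto simp: e_def)
    ultimately show ?thesis using c(2) by (intro exI[of _ e]) simp
  qed
qed

lemma sob_weight_ge_1:
  assumes "\<And>j. j \<in> {1..d} \<Longrightarrow> a j \<ge> 0"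
  shows "sob_weight a b d k \<ge> 1"
  unfolding sob_weight_def using assms by (auto intro!: sum_nonneg mult_nonneg_nonneg)

text \<open>Density makes the Bessel defect of some finite \<open>F\<close> smaller than
  \<open>\<epsilon>\<close>, so the error of the partial sum over \<open>M\<close> is at most
  \<open>\<epsilon>\<close> plus the coefficients in \<open>F - M\<close>, each of which costs at
  least \<open>T\<close> in the weighted norm. Taking \<open>M\<close> empty and
  \<open>T = 1\<close> also bounds the embedding itself by 1.\<close>

lemma fourier_tail_bound:
  assumes d: "d \<ge> 1" and a: "\<And>j. j \<in> {1..d} \<Longrightarrow> a j \<ge> 0"
    and f: "f \<in> Wspace a b d"
    and M: "finite M" "M \<subseteq> freq d"
    and T: "T > 0" "\<And>k. k \<in> freq d - M \<Longrightarrow> T \<le> sob_weight a b d k"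
  shows "L2norm d (\<lambda>x. f x - (\<Sum>k\<in>M. fourier d f k * emode d k x)) \<le> 1 / sqrt T * Wnorm a b d f"
proof -
  define w where "w k = sob_weight a b d k * (cmod (fourier d f k))^2" for k
  have w0: "w k \<ge> 0" for k
    using sob_weight_ge_1[of d a b k] a by (auto simp: w_def intro!: mult_nonneg_nonneg)
  have fL: "f \<in> L2 d" and sm: "w summable_on freq d"
    using f by (auto simp: Wspace_def w_def[abs_def])
  define R where "R = (\<integral>x. (cmod (f x - (\<Sum>k\<in>M. fourier d f k * emode d k x)))^2 \<partial>cubeM d)"
  have R: "R = (\<integral>x. (cmod (f x))^2 \<partial>cubeM d) - (\<Sum>k\<in>M. (cmod (fourier d f k))^2)"
    unfolding R_def integral_residual[OF fL M] by simp
  have "R \<le> \<epsilon> + infsum w (freq d) / T" if \<epsilon>: "\<epsilon> > 0" for \<epsilon>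
  proof -
    obtain p where p: "p \<in> trig d" "(\<integral>x. (cmod (f x - p x))^2 \<partial>cubeM d) < \<epsilon>"
      using trig_approx_L2[OF d fL] \<epsilon> unfolding trig_approx_def by blast
    obtain F c where F: "finite F" "F \<subseteq> freq d" "p = (\<lambda>x. \<Sum>k\<in>F. c k * emode d k x)"
      using trig_explicit[OF p(1)] by blast
    \<comment> \<open>The squared error of \<open>p\<close> is this defect plus a nonnegative
      sum.\<close>
    have "(\<integral>x. (cmod (f x))^2 \<partial>cubeM d) - (\<Sum>k\<in>F. (cmod (fourier d f k))^2) < \<epsilon>"
      using p(2) integral_residual[OF fL F(1,2), of c] unfolding F(3)
      by (smt (verit) sum_nonneg zero_le_power2)
    moreover have "(\<Sum>k\<in>F. (cmod (fourier d f k))^2) \<le>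
        (\<Sum>k\<in>M. (cmod (fourier d f k))^2) + (\<Sum>k\<in>F - M. (cmod (fourier d f k))^2)"
      using F(1) M(1) by (subst sum.union_disjoint[symmetric]) (auto intro!: sum_mono2)
    moreover have "(\<Sum>k\<in>F - M. (cmod (fourier d f k))^2) \<le> (\<Sum>k\<in>F - M. w k / T)"
    proof (rule sum_mono)
      fix k assume "k \<in> F - M"
      then have "T \<le> sob_weight a b d k" using F(2) T(2) by blast
      then have "T * (cmod (fourier d f k))^2 \<le> w k"
        unfolding w_def by (intro mult_right_mono) auto
      then show "(cmod (fourier d f k))^2 \<le> w k / T"
        using T(1) by (simp add: field_simps)
    qed
    moreover have "(\<Sum>k\<in>F - M. w k / T) \<le> infsum w (freq d) / T"
      unfolding sum_divide_distrib[symmetric] using F(1,2) T(1) w0 sm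
      by (intro divide_right_mono finite_sum_le_infsum) auto
    ultimately show ?thesis using R by linarith
  qed
  then have "R \<le> infsum w (freq d) / T"
    using field_le_epsilon[of R "infsum w (freq d) / T"] by (simp add: add.commute)
  then have "sqrt R \<le> sqrt (infsum w (freq d) / T)" by simp
  then show ?thesis
    by (simp add: L2norm_def Wnorm_def R_def w_def[abs_def] real_sqrt_divide)
qed

text \<open>The competitor is the Fourier partial sum over \<open>M\<close>, whose rank is at most
  \<open>card M\<close>.\<close>

lemma approx_num_le:
  assumes d: "d \<ge> 1" and a: "\<And>j. j \<in> {1..d} \<Longrightarrow> a j \<ge> 0"
    and M: "finite M" "M \<subseteq> freq d" "card M < n"
    and T: "T > 0" "\<And>k. k \<in> freq d - M \<Longrightarrow> T \<le> sob_weight a b d k"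
  shows "approx_num a b d n \<le> 1 / sqrt T"
  unfolding approx_num_def
proof (rule cInf_lower, rule CollectI, intro conjI exI)
  let ?A = "\<lambda>f x. \<Sum>k\<in>M. fourier d f k * emode d k x"
  show "0 \<le> 1 / sqrt T" using T by simp
  show "\<forall>f\<in>Wspace a b d. ?A f \<in> L2 d" by (simp add: L2_trig)
  show "\<forall>f\<in>Wspace a b d. \<forall>g\<in>Wspace a b d. \<forall>\<alpha> \<beta>. AE x in cubeM d.
      ?A (\<lambda>y. \<alpha> * f y + \<beta> * g y) x = \<alpha> * ?A f x + \<beta> * ?A g x"
    by (auto simp: Wspace_def fourier_lincomb sum_distrib_left sum.distrib[symmetric] algebra_simps)
  show "finite (emode d ` M)" using M by simp
  show "card (emode d ` M) < n" using M card_image_le[of M "emode d"] by simp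
  show "emode d ` M \<subseteq> L2 d" by (auto simp: emode_L2)
  show "\<forall>f\<in>Wspace a b d. \<exists>coef. AE x in cubeM d. ?A f x = (\<Sum>g\<in>emode d ` M. coef g * g x)"
  proof
    fix f
    \<comment> \<open>The span is indexed by functions instead of frequencies; collecting
      coefficients over the fibres of \<open>emode d\<close> makes an injectivity proof
      unnecessary.\<close>
    have "?A f x = (\<Sum>g\<in>emode d ` M. (\<Sum>k\<in>{k\<in>M. emode d k = g}. fourier d f k) * g x)" for x
      unfolding sum.image_gen[OF M(1), of "\<lambda>k. fourier d f k * emode d k x" "emode d"]
      by (intro sum.cong refl) (simp add: sum_distrib_right)
    then show "\<exists>coef. AE x in cubeM d. ?A f x = (\<Sum>g\<in>emode d ` M. coef g * g x)"
      by (intro exI[of _ "\<lambda>g. \<Sum>k\<in>{k\<in>M. emode d k = g}. fourier d f k"]) simp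
  qed
  show "\<forall>f\<in>Wspace a b d. L2norm d (\<lambda>x. f x - ?A f x) \<le> 1 / sqrt T * Wnorm a b d f"
    using fourier_tail_bound[OF d a _ M(1,2) T] by blast
qed (auto intro!: bdd_belowI[of _ 0])

lemma trig_Wspace:
  assumes "finite F" "F \<subseteq> freq d"
  shows "(\<lambda>x. \<Sum>k\<in>F. c k * emode d k x) \<in> Wspace a b d"
    and "Wnorm a b d (\<lambda>x. \<Sum>k\<in>F. c k * emode d k x) =
      sqrt (\<Sum>k\<in>F. sob_weight a b d k * (cmod (c k))^2)"
    and "L2norm d (\<lambda>x. \<Sum>k\<in>F. c k * emode d k x) = sqrt (\<Sum>k\<in>F. (cmod (c k))^2)"
proof -
  let ?f = "\<lambda>x. \<Sum>k\<in>F. c k * emode d k x"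
  have eq: "sob_weight a b d k * (cmod (fourier d ?f k))^2 =
      (if k \<in> F then sob_weight a b d k * (cmod (c k))^2 else 0)" if "k \<in> freq d" for k
    using fourier_trig[OF assms that] by simp
  have "(\<lambda>k. sob_weight a b d k * (cmod (fourier d ?f k))^2) summable_on freq d \<longleftrightarrow>
      (\<lambda>k. sob_weight a b d k * (cmod (c k))^2) summable_on F"
    by (rule summable_on_cong_neutral) (use eq assms in auto)
  then show "?f \<in> Wspace a b d"
    using assms by (simp add: Wspace_def L2_trig)
  have "infsum (\<lambda>k. sob_weight a b d k * (cmod (fourier d ?f k))^2) (freq d) =
      infsum (\<lambda>k. sob_weight a b d k * (cmod (c k))^2) F"
    by (rule infsum_cong_neutral) (use eq assms in auto)
  then show "Wnorm a b d ?f = sqrt (\<Sum>k\<in>F. sob_weight a b d k * (cmod (c k))^2)"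
    using assms by (simp add: Wnorm_def)
  have "(\<Sum>k\<in>F. (cmod (fourier d ?f k))^2) = (\<Sum>k\<in>F. (cmod (c k))^2)"
    using assms by (intro sum.cong refl) (simp add: fourier_trig subset_iff)
  then show "L2norm d ?f = sqrt (\<Sum>k\<in>F. (cmod (c k))^2)"
    using integral_residual[OF L2_trig[where F=F and c=c] assms, of c] assms
    by (simp add: L2norm_def fourier_trig subset_iff)
qed

text \<open>Competitors are linear only almost everywhere and only on \<open>Wspace a b d\<close>.
  Finitely many exceptional null sets are merged, and every partial sum is checked to belong to the
  space.\<close>

lemma linear_on_trig:
  assumes lin: "\<And>f g \<alpha> \<beta>. f \<in> Wspace a b d \<Longrightarrow> g \<in> Wspace a b d \<Longrightarrow>
      AE x in cubeM d. A (\<lambda>y. \<alpha> * f y + \<beta> * g y) x = \<alpha> * A f x + \<beta> * A g x"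
    and F: "finite F" "F \<subseteq> freq d"
  shows "AE x in cubeM d. A (\<lambda>y. \<Sum>k\<in>F. c k * emode d k y) x = (\<Sum>k\<in>F. c k * A (emode d k) x)"
  using F
proof (induction F rule: finite_induct)
  case empty
  have "(\<lambda>_. 0) \<in> Wspace a b d" using trig_Wspace(1)[of "{}"] by simp
  from lin[OF this this, of 0 0] show ?case by simp
next
  case (insert k F)
  have 1: "emode d k \<in> Wspace a b d"
    using trig_Wspace(1)[of "{k}" d "\<lambda>_. 1"] insert.prems by simp
  have 2: "(\<lambda>x. \<Sum>k\<in>F. c k * emode d k x) \<in> Wspace a b d"
    using trig_Wspace(1) insert by auto
  have "AE x in cubeM d. A (\<lambda>y. \<Sum>k\<in>F. c k * emode d k y) x = (\<Sum>k\<in>F. c k * A (emode d k) x)"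
    using insert by simp
  with lin[OF 1 2, of "c k" 1] show ?case
    by eventually_elim (use insert.hyps in simp)
qed

text \<open>On the span of the modes in \<open>M\<close> the weighted norm is at most
  \<open>sqrt T\<close> times the \<open>L2\<close> norm. A competitor of rank below
  \<open>n\<close> vanishes at some nonzero \<open>f\<close> of that span, where the error is the
  full norm of \<open>f\<close>; this forces \<open>1 \<le> c * sqrt T\<close>.\<close>

lemma approx_num_ge:
  assumes d: "d \<ge> 1" and n: "n \<ge> 1" and a: "\<And>j. j \<in> {1..d} \<Longrightarrow> a j \<ge> 0"
    and M: "finite M" "M \<subseteq> freq d" "n \<le> card M"
    and T: "\<And>k. k \<in> M \<Longrightarrow> sob_weight a b d k \<le> T"
  shows "1 / sqrt T \<le> approx_num a b d n"
proof -
  obtain k0 where "k0 \<in> M" using M n by (metis card.empty ex_in_conv le_zero_eq not_one_le_zero)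
  then have T1: "T \<ge> 1" using T[of k0] sob_weight_ge_1[of d a b k0] a by auto
  let ?lin = "\<lambda>A. \<forall>f\<in>Wspace a b d. \<forall>g\<in>Wspace a b d. \<forall>\<alpha> \<beta> :: complex.
      AE x in cubeM d. A (\<lambda>y. \<alpha> * f y + \<beta> * g y) x = \<alpha> * A f x + \<beta> * A g x"
  have lower: "1 / sqrt T \<le> c"
    if c: "c \<ge> 0" and AL: "\<forall>f\<in>Wspace a b d. A f \<in> L2 d" and lin: "?lin A" and G: "finite G" "card G < n"
      and span: "\<forall>f\<in>Wspace a b d. \<exists>coef. AE x in cubeM d. A f x = (\<Sum>g\<in>G. coef g * g x)"
      and bd: "\<forall>f\<in>Wspace a b d. L2norm d (\<lambda>x. f x - A f x) \<le> c * Wnorm a b d f"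
    for c A G
  proof -
    have "emode d k \<in> Wspace a b d" if "k \<in> M" for k
      using trig_Wspace(1)[of "{k}" d "\<lambda>_. 1"] M(2) that by auto
    then have "\<forall>k\<in>M. \<exists>coef. AE x in cubeM d. A (emode d k) x = (\<Sum>g\<in>G. coef g * g x)"
      using span by blast
    from bchoice[OF this] obtain m
      where m: "\<forall>k\<in>M. AE x in cubeM d. A (emode d k) x = (\<Sum>g\<in>G. m k g * g x)"
      by (rule exE)
    \<comment> \<open>One equation for each spanning function, one unknown for each frequency: fewer
      than \<open>n\<close> equations against at least \<open>n\<close> unknowns.\<close>
    obtain e where e: "\<exists>k\<in>M. e k \<noteq> 0" "\<forall>g\<in>G. (\<Sum>k\<in>M. e k * m k g) = 0"
      using homogeneous_system_nontrivial[OF G(1) M(1), of m] G(2) M(3) by auto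
    define f where "f x = (\<Sum>k\<in>M. e k * emode d k x)" for x
    have fW: "f \<in> Wspace a b d" unfolding f_def[abs_def] by (rule trig_Wspace(1)[OF M(1,2)])
    have "AE x in cubeM d. A f x = (\<Sum>k\<in>M. e k * A (emode d k) x)"
      unfolding f_def[abs_def] by (rule linear_on_trig[OF lin[rule_format] M(1,2)])
    moreover have "AE x in cubeM d. \<forall>k\<in>M. A (emode d k) x = (\<Sum>g\<in>G. m k g * g x)"
      using m M(1) by (simp add: AE_finite_all)
    ultimately have "AE x in cubeM d. A f x = 0"
    proof eventually_elim
      fix x assume "A f x = (\<Sum>k\<in>M. e k * A (emode d k) x)"
        "\<forall>k\<in>M. A (emode d k) x = (\<Sum>g\<in>G. m k g * g x)"
      then have "A f x = (\<Sum>k\<in>M. \<Sum>g\<in>G. e k * m k g * g x)"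
        by (simp add: sum_distrib_left mult.assoc)
      also have "\<dots> = (\<Sum>g\<in>G. (\<Sum>k\<in>M. e k * m k g) * g x)"
        by (subst sum.swap) (simp add: sum_distrib_right)
      finally show "A f x = 0" using e(2) by simp
    qed
    then have "AE x in cubeM d. (cmod (f x - A f x))^2 = (cmod (f x))^2"
      by eventually_elim simp
    moreover have "f \<in> L2 d" "A f \<in> L2 d" using fW AL by (auto simp: Wspace_def)
    ultimately have "L2norm d (\<lambda>x. f x - A f x) = L2norm d f"
      unfolding L2norm_def using L2D(1)
      by (intro arg_cong[of _ _ sqrt] integral_cong_AE borel_measurable_power
          borel_measurable_norm borel_measurable_diff) auto
    moreover have "L2norm d (\<lambda>x. f x - A f x) \<le> c * Wnorm a b d f" using bd fW by blast
    moreover have "Wnorm a b d f = sqrt (\<Sum>k\<in>M. sob_weight a b d k * (cmod (e k))^2)"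
      "L2norm d f = sqrt (\<Sum>k\<in>M. (cmod (e k))^2)"
      unfolding f_def[abs_def] by (rule trig_Wspace(2,3)[OF M(1,2)])+
    ultimately have "sqrt (\<Sum>k\<in>M. (cmod (e k))^2) \<le> c * sqrt (\<Sum>k\<in>M. sob_weight a b d k * (cmod (e k))^2)"
      by simp
    also have "\<dots> \<le> c * sqrt (T * (\<Sum>k\<in>M. (cmod (e k))^2))"
      unfolding sum_distrib_left using c T
      by (intro mult_left_mono real_sqrt_le_mono sum_mono mult_right_mono) auto
    finally have "sqrt (\<Sum>k\<in>M. (cmod (e k))^2) * 1 \<le> sqrt (\<Sum>k\<in>M. (cmod (e k))^2) * (c * sqrt T)"
      by (simp add: real_sqrt_mult mult_ac)
    moreover have "(\<Sum>k\<in>M. (cmod (e k))^2) > 0"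
    proof -
      from e(1) obtain k where "k \<in> M" "e k \<noteq> 0" by blast
      then show ?thesis using M(1) by (intro sum_pos2[of M k]) auto
    qed
    ultimately have "1 \<le> c * sqrt T"
      by (simp only: mult_le_cancel_left_pos real_sqrt_gt_zero)
    then show ?thesis using T1 by (simp add: field_simps)
  qed
  show ?thesis
    unfolding approx_num_def
  proof (rule cInf_greatest)
    fix c assume "c \<in> {c. c \<ge> 0 \<and> (\<exists>A :: ((nat \<Rightarrow> real) \<Rightarrow> complex) \<Rightarrow> ((nat \<Rightarrow> real) \<Rightarrow> complex).
      (\<forall>f\<in>Wspace a b d. A f \<in> L2 d) \<and> ?lin A \<and>
      (\<exists>G. finite G \<and> card G < n \<and> G \<subseteq> L2 d \<and>
          (\<forall>f\<in>Wspace a b d. \<exists>coef::((nat \<Rightarrow> real) \<Rightarrow> complex) \<Rightarrow> complex.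
              AE x in cubeM d. A f x = (\<Sum>g\<in>G. coef g * g x))) \<and>
      (\<forall>f\<in>Wspace a b d. L2norm d (\<lambda>x. f x - A f x) \<le> c * Wnorm a b d f))}"
    then show "1 / sqrt T \<le> c" using lower by blast
  next
    \<comment> \<open>The greatest-lower-bound rule needs a nonempty set of constants. The zero
      operator has rank 0, admissible since \<open>n \<ge> 1\<close>, and achieves the constant
      1.\<close>
    have "L2norm d f \<le> Wnorm a b d f" if "f \<in> Wspace a b d" for f
      using fourier_tail_bound[OF d a that, of "{}" 1] sob_weight_ge_1 a by simp
    then have "1 \<in> {c. c \<ge> 0 \<and> (\<exists>A :: ((nat \<Rightarrow> real) \<Rightarrow> complex) \<Rightarrow> ((nat \<Rightarrow> real) \<Rightarrow> complex).
      (\<forall>f\<in>Wspace a b d. A f \<in> L2 d) \<and> ?lin A \<and>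
      (\<exists>G. finite G \<and> card G < n \<and> G \<subseteq> L2 d \<and>
          (\<forall>f\<in>Wspace a b d. \<exists>coef::((nat \<Rightarrow> real) \<Rightarrow> complex) \<Rightarrow> complex.
              AE x in cubeM d. A f x = (\<Sum>g\<in>G. coef g * g x))) \<and>
      (\<forall>f\<in>Wspace a b d. L2norm d (\<lambda>x. f x - A f x) \<le> c * Wnorm a b d f))}"
      using n L2_trig[where F="{}"]
      by (intro CollectI conjI exI[of _ "\<lambda>_ _. 0"] exI[of _ "{}"]) auto
    then show "{c. c \<ge> 0 \<and> (\<exists>A :: ((nat \<Rightarrow> real) \<Rightarrow> complex) \<Rightarrow> ((nat \<Rightarrow> real) \<Rightarrow> complex).
      (\<forall>f\<in>Wspace a b d. A f \<in> L2 d) \<and> ?lin A \<and>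
      (\<exists>G. finite G \<and> card G < n \<and> G \<subseteq> L2 d \<and>
          (\<forall>f\<in>Wspace a b d. \<exists>coef::((nat \<Rightarrow> real) \<Rightarrow> complex) \<Rightarrow> complex.
              AE x in cubeM d. A f x = (\<Sum>g\<in>G. coef g * g x))) \<and>
      (\<forall>f\<in>Wspace a b d. L2norm d (\<lambda>x. f x - A f x) \<le> c * Wnorm a b d f))} \<noteq> {}"
      by blast
  qed
qed

section \<open>Counting lattice points in anisotropic balls\<close>

definition lebN :: "nat \<Rightarrow> (nat \<Rightarrow> real) measure" where
  "lebN d = PiM {1..d} (\<lambda>_. lborel)"

definition aniso :: "(nat \<Rightarrow> real) \<Rightarrow> (nat \<Rightarrow> real) \<Rightarrow> nat \<Rightarrow> (nat \<Rightarrow> real) \<Rightarrow> real" where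
  "aniso a b d x = (\<Sum>j\<in>{1..d}. a j * \<bar>x j\<bar> powr (2 * b j))"

definition dil :: "(nat \<Rightarrow> real) \<Rightarrow> real \<Rightarrow> nat \<Rightarrow> real" where
  "dil b t j = t powr (1 / (2 * b j))"

definition vol_exp :: "(nat \<Rightarrow> real) \<Rightarrow> nat \<Rightarrow> real" where
  "vol_exp b d = (\<Sum>j\<in>{1..d}. 1 / (2 * b j))"

definition lattice_ball :: "(nat \<Rightarrow> real) \<Rightarrow> (nat \<Rightarrow> real) \<Rightarrow> nat \<Rightarrow> real \<Rightarrow> (nat \<Rightarrow> int) set" where
  "lattice_ball a b d t = {k \<in> freq d. aniso a b d (\<lambda>j. real_of_int (k j)) \<le> t}"

interpretation lebs: product_sigma_finite "\<lambda>_::nat. lborel :: real measure"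
  by standard

lemma space_lebN: "space (lebN d) = PiE {1..d} (\<lambda>_. UNIV)"
  by (simp add: lebN_def space_PiM)

lemma measurable_component_lebN:
  assumes "j \<in> {1..d}"
  shows "(\<lambda>x. x j) \<in> borel_measurable (lebN d)"
  unfolding lebN_def
  using measurable_component_singleton[OF assms, of "\<lambda>_. lborel"] by (simp only: measurable_lborel1)

lemma aniso_measurable:
  assumes "\<And>j. j \<in> {1..d} \<Longrightarrow> (\<lambda>x. f x j) \<in> borel_measurable M"
  shows "(\<lambda>x. aniso a b d (f x)) \<in> borel_measurable M"
  unfolding aniso_def
  by (intro borel_measurable_sum borel_measurable_times borel_measurable_const
      powr_real_measurable borel_measurable_abs assms)

lemma aniso_le_sets:
  assumes "\<And>j. j \<in> {1..d} \<Longrightarrow> (\<lambda>x. f x j) \<in> borel_measurable M"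
  shows "{x \<in> space M. aniso a b d (f x) \<le> t} \<in> sets M"
  by (rule borel_measurable_le[OF aniso_measurable[OF assms] borel_measurable_const])

lemma aniso_cong: "(\<And>j. j \<in> {1..d} \<Longrightarrow> x j = y j) \<Longrightarrow> aniso a b d x = aniso a b d y"
  by (simp add: aniso_def)

lemma emeasure_lborel_scale:
  fixes c :: real
  assumes "c > 0" "A \<in> sets borel"
  shows "emeasure lborel A = ennreal c * emeasure lborel {y. c * y \<in> A}"
proof -
  have "emeasure lborel A = emeasure (density (distr lborel borel ((*) c)) (\<lambda>_. ennreal \<bar>c\<bar>)) A"
    using lborel_distr_mult'[of c] assms by simp
  also have "\<dots> = ennreal c * emeasure (distr lborel borel ((*) c)) A"
    using assms by (simp add: emeasure_density_const)
  also have "emeasure (distr lborel borel ((*) c)) A = emeasure lborel {y. c * y \<in> A}"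
    using assms by (subst emeasure_distr) (auto simp: vimage_def)
  finally show ?thesis .
qed

text \<open>The rescaled image measure agrees with the product measure on measurable boxes by the
  one-dimensional case, hence everywhere by uniqueness of product measures. Restriction to
  \<open>{1..d}\<close> keeps the dilated point extensional.\<close>

lemma measure_lebN_scale:
  assumes c: "\<And>j. j \<in> {1..d} \<Longrightarrow> c j > 0" and S: "S \<in> sets (lebN d)"
  shows "measure (lebN d) S =
    (\<Prod>j\<in>{1..d}. c j) * measure (lebN d) {y \<in> space (lebN d). (\<lambda>j\<in>{1..d}. c j * y j) \<in> S}"
proof -
  define T where "T y = (\<lambda>j\<in>{1..d}. c j * y j)" for y :: "nat \<Rightarrow> real"
  have T[measurable]: "T \<in> measurable (lebN d) (lebN d)"
    unfolding T_def lebN_def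
  proof (rule measurable_restrict)
    fix j assume "j \<in> {1..d}"
    then have "(\<lambda>y. c j * y j) \<in> borel_measurable (lebN d)"
      by (intro borel_measurable_times borel_measurable_const measurable_component_lebN)
    then show "(\<lambda>y. c j * y j) \<in> measurable (PiM {1..d} (\<lambda>_. lborel)) lborel"
      unfolding measurable_lborel1 lebN_def .
  qed
  define P where "P = scale_measure (ennreal (\<Prod>j\<in>{1..d}. c j)) (distr (lebN d) (lebN d) T)"
  have "P = PiM {1..d} (\<lambda>_. lborel)"
  proof (rule lebs.PiM_eqI)
    show "sets P = sets (PiM {1..d} (\<lambda>_. lborel))" by (simp add: P_def lebN_def)
    fix A assume A: "\<And>i. i \<in> {1..d} \<Longrightarrow> A i \<in> sets (lborel :: real measure)"
    have pre: "T -` PiE {1..d} A \<inter> space (lebN d) = PiE {1..d} (\<lambda>j. {y. c j * y \<in> A j})"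
      by (auto simp: T_def space_lebN PiE_iff)
    have meas: "{y. c j * y \<in> A j} \<in> sets lborel" if "j \<in> {1..d}" for j
    proof -
      have "(*) (c j) -` A j \<inter> space borel \<in> sets borel"
        using A[OF that] by (intro measurable_sets[of _ borel borel]) auto
      then show ?thesis by (simp add: vimage_def)
    qed
    have "emeasure P (PiE {1..d} A) =
        ennreal (\<Prod>j\<in>{1..d}. c j) * emeasure (lebN d) (PiE {1..d} (\<lambda>j. {y. c j * y \<in> A j}))"
      unfolding P_def emeasure_scale_measure pre[symmetric]
      using A by (subst emeasure_distr[OF T]) (auto simp: lebN_def intro!: sets_PiM_I_finite)
    also have "\<dots> = (\<Prod>j\<in>{1..d}. ennreal (c j) * emeasure lborel {y. c j * y \<in> A j})"
      unfolding lebN_def prod.distrib using meas c less_imp_le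
      by (subst lebs.emeasure_PiM, simp, blast) (subst prod_ennreal, auto)
    also have "\<dots> = (\<Prod>j\<in>{1..d}. emeasure lborel (A j))"
      using A c by (intro prod.cong refl emeasure_lborel_scale[symmetric]) auto
    finally show "emeasure P (PiE {1..d} A) = (\<Prod>j\<in>{1..d}. emeasure lborel (A j))" .
  qed simp
  then have "emeasure (lebN d) S = emeasure P S" by (simp add: lebN_def)
  also have "\<dots> = ennreal (\<Prod>j\<in>{1..d}. c j) * emeasure (lebN d) {y \<in> space (lebN d). T y \<in> S}"
    unfolding P_def emeasure_scale_measure
    by (subst emeasure_distr[OF T S]) (simp add: vimage_def Int_def conj_commute)
  moreover have "(\<Prod>j\<in>{1..d}. c j) \<ge> 0" by (intro prod_nonneg less_imp_le c)
  ultimately show ?thesis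
    by (simp add: measure_def T_def enn2real_mult)
qed

section \<open>Volume, boundary and lattice points of anisotropic balls\<close>

locale anisotropic =
  fixes a b :: "nat \<Rightarrow> real" and d :: nat
  assumes a: "\<And>j. j \<in> {1..d} \<Longrightarrow> a j > 0" and b: "\<And>j. j \<in> {1..d} \<Longrightarrow> b j > 0"
    and d: "d \<ge> 1"
begin

abbreviation "\<phi> \<equiv> aniso a b d"
abbreviation "\<sigma> \<equiv> vol_exp b d"

lemma sigma_pos: "\<sigma> > 0"
  unfolding vol_exp_def using b d by (intro sum_pos) auto

lemma dil_pos: "t > 0 \<Longrightarrow> dil b t j > 0"
  by (simp add: dil_def)

lemma prod_dil:
  assumes "t > 0"
  shows "(\<Prod>j\<in>{1..d}. dil b t j) = t powr \<sigma>"
  unfolding dil_def vol_exp_def using assms by (simp add: powr_sum)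

lemma aniso_dil:
  assumes "t > 0"
  shows "\<phi> (\<lambda>j. dil b t j * x j) = t * \<phi> x"
proof -
  have "\<bar>dil b t j * x j\<bar> powr (2 * b j) = t * \<bar>x j\<bar> powr (2 * b j)" if "j \<in> {1..d}" for j
    using assms b[OF that] by (simp add: dil_def abs_mult powr_mult powr_powr)
  then show ?thesis
    by (simp add: aniso_def sum_distrib_left mult.left_commute)
qed

lemma aniso_term_le: "j \<in> {1..d} \<Longrightarrow> a j * \<bar>x j\<bar> powr (2 * b j) \<le> \<phi> x"
  unfolding aniso_def using a less_imp_le
  by (intro member_le_sum) (auto intro!: mult_nonneg_nonneg)

lemma aniso_le_1_bound:
  assumes "\<phi> x \<le> 1" "j \<in> {1..d}"
  shows "\<bar>x j\<bar> \<le> (1 / a j) powr (1 / (2 * b j))"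
proof -
  have "a j * \<bar>x j\<bar> powr (2 * b j) \<le> 1" using aniso_term_le[OF assms(2)] assms(1) by (rule order_trans)
  then have "\<bar>x j\<bar> powr (2 * b j) \<le> 1 / a j" using a[OF assms(2)] by (simp add: field_simps)
  then have "(\<bar>x j\<bar> powr (2 * b j)) powr (1 / (2 * b j)) \<le> (1 / a j) powr (1 / (2 * b j))"
    using b[OF assms(2)] by (intro powr_mono2) auto
  then show ?thesis using b[OF assms(2)] by (simp add: powr_powr)
qed

definition aniso_ball :: "real \<Rightarrow> (nat \<Rightarrow> real) set" where
  "aniso_ball t = {x \<in> space (lebN d). \<phi> x \<le> t}"

lemma aniso_ball_sets: "aniso_ball t \<in> sets (lebN d)"
  unfolding aniso_ball_def by (rule aniso_le_sets) (rule measurable_component_lebN)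

text \<open>The margin 1 leaves room for rounding: for \<open>t \<ge> 1\<close> a rescaled lattice
  point differs from \<open>x j\<close> by at most \<open>1 / dil b t j \<le> 1\<close>. One box
  thus serves as majorant for all these \<open>t\<close>.\<close>

definition bounding_box :: "(nat \<Rightarrow> real) set" where
  "bounding_box = PiE {1..d} (\<lambda>j. {- ((1 / a j) powr (1 / (2 * b j)) + 1) .. (1 / a j) powr (1 / (2 * b j)) + 1})"

lemma bounding_box_sets: "bounding_box \<in> sets (lebN d)"
  unfolding bounding_box_def lebN_def by (rule sets_PiM_I_finite) auto

lemma emeasure_box: "emeasure (lebN d) bounding_box < \<infinity>"
proof -
  have "emeasure (lebN d) bounding_box = (\<Prod>j\<in>{1..d}. emeasure lborel
      {- ((1 / a j) powr (1 / (2 * b j)) + 1) .. (1 / a j) powr (1 / (2 * b j)) + 1})"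
    unfolding bounding_box_def lebN_def by (rule lebs.emeasure_PiM) auto
  also have "\<dots> \<noteq> \<infinity>"
    unfolding infinity_ennreal_def ennreal_prod_eq_top
    using emeasure_bounded_finite[OF bounded_closed_interval] by (auto simp: less_top)
  finally show ?thesis by (simp add: less_top)
qed

lemma ball_subset_box: "aniso_ball 1 \<subseteq> bounding_box"
proof
  fix x assume "x \<in> aniso_ball 1"
  then have x: "x \<in> PiE {1..d} (\<lambda>_. UNIV)" "\<phi> x \<le> 1" by (auto simp: aniso_ball_def space_lebN)
  show "x \<in> bounding_box" unfolding bounding_box_def
  proof (rule PiE_I)
    fix j assume "j \<in> {1..d}"
    from aniso_le_1_bound[OF x(2) this]
    show "x j \<in> {- ((1 / a j) powr (1 / (2 * b j)) + 1) .. (1 / a j) powr (1 / (2 * b j)) + 1}"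
      by (auto simp: abs_le_iff)
  qed (use x in auto)
qed

lemma emeasure_ball_1: "emeasure (lebN d) (aniso_ball 1) < \<infinity>"
  using emeasure_mono[OF ball_subset_box bounding_box_sets] emeasure_box by (rule le_less_trans)

lemma ball_vol_eq: "ball_vol a b d = measure (lebN d) (aniso_ball 1)"
  by (simp add: ball_vol_def aniso_ball_def lebN_def space_PiM aniso_def)

text \<open>The map \<open>u\<close> is kept general to serve twice: the identity gives the scaling
  law of the balls, the floor function gives the rescaled lattice count.\<close>

lemma measure_coordinatewise_ball:
  fixes u :: "real \<Rightarrow> real"
  assumes u: "u \<in> borel_measurable borel" and t: "t > 0"
  shows "measure (lebN d) {x \<in> space (lebN d). \<phi> (\<lambda>j. u (x j)) \<le> s} = t powr \<sigma> *
    measure (lebN d) {x \<in> space (lebN d). \<phi> (\<lambda>j. u (dil b t j * x j)) \<le> s}"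
proof -
  let ?S = "{x \<in> space (lebN d). \<phi> (\<lambda>j. u (x j)) \<le> s}"
  have S: "?S \<in> sets (lebN d)"
    by (rule aniso_le_sets) (rule measurable_compose[OF measurable_component_lebN u])
  have "{y \<in> space (lebN d). (\<lambda>j\<in>{1..d}. dil b t j * y j) \<in> ?S} =
      {x \<in> space (lebN d). \<phi> (\<lambda>j. u (dil b t j * x j)) \<le> s}"
  proof (rule Collect_cong, rule conj_cong[OF refl])
    fix y :: "nat \<Rightarrow> real"
    have "\<phi> (\<lambda>j. u ((\<lambda>j\<in>{1..d}. dil b t j * y j) j)) = \<phi> (\<lambda>j. u (dil b t j * y j))"
      by (rule aniso_cong) simp
    then show "(\<lambda>j\<in>{1..d}. dil b t j * y j) \<in> ?S \<longleftrightarrow> \<phi> (\<lambda>j. u (dil b t j * y j)) \<le> s"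
      by (simp add: space_lebN)
  qed
  then show ?thesis
    using measure_lebN_scale[of d "dil b t", OF dil_pos[OF t] S] unfolding prod_dil[OF t] by (simp only:)
qed

lemma measure_ball:
  assumes "t > 0"
  shows "measure (lebN d) (aniso_ball t) = t powr \<sigma> * ball_vol a b d"
  using measure_coordinatewise_ball[OF _ assms, of "\<lambda>x. x" t] assms
  by (simp add: aniso_ball_def aniso_dil ball_vol_eq)

text \<open>The shells between radius $s < 1$ and $1$ have measure $(1 - s^\sigma)$ times the volume.\<close>

lemma AE_aniso_neq_1: "AE x in lebN d. \<phi> x \<noteq> 1"
proof -
  let ?N = "{x \<in> space (lebN d). \<phi> x = 1}"
  have N: "?N \<in> sets (lebN d)"
    by (rule borel_measurable_eq[OF aniso_measurable borel_measurable_const])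
       (rule measurable_component_lebN)
  have Nsub: "?N \<subseteq> aniso_ball 1" by (auto simp: aniso_ball_def)
  have fin: "emeasure (lebN d) ?N < \<infinity>"
    using emeasure_mono[OF Nsub aniso_ball_sets] emeasure_ball_1 by (rule le_less_trans)
  have "measure (lebN d) ?N \<le> (1 - s powr \<sigma>) * ball_vol a b d" if s: "0 < s" "s < 1" for s
  proof -
    have sub: "aniso_ball s \<subseteq> aniso_ball 1" using s by (auto simp: aniso_ball_def)
    have fm: "aniso_ball 1 \<in> fmeasurable (lebN d)"
      using aniso_ball_sets emeasure_ball_1 by (intro fmeasurableI) auto
    have "measure (lebN d) ?N \<le> measure (lebN d) (aniso_ball 1 - aniso_ball s)"
    proof (rule measure_mono_fmeasurable[OF _ N fmeasurable_Diff[OF fm aniso_ball_sets]])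
      show "?N \<subseteq> aniso_ball 1 - aniso_ball s" using s by (auto simp: aniso_ball_def)
    qed
    also have "\<dots> = measure (lebN d) (aniso_ball 1) - measure (lebN d) (aniso_ball s)"
      using emeasure_ball_1 by (intro measure_Diff aniso_ball_sets sub) simp
    also have "\<dots> = (1 - s powr \<sigma>) * ball_vol a b d"
      using measure_ball[OF s(1)] by (simp add: ball_vol_eq algebra_simps)
    finally show ?thesis .
  qed
  then have ev: "eventually (\<lambda>s. measure (lebN d) ?N \<le> (1 - s powr \<sigma>) * ball_vol a b d) (at_left 1)"
    using eventually_at_left_real[of 0 1] by (auto elim!: eventually_mono)
  have "((\<lambda>s. (1 - s powr \<sigma>) * ball_vol a b d) \<longlongrightarrow> (1 - 1 powr \<sigma>) * ball_vol a b d) (at_left 1)"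
    by (intro tendsto_intros) auto
  then have "measure (lebN d) ?N \<le> (1 - 1 powr \<sigma>) * ball_vol a b d"
    using ev by (intro tendsto_lowerbound) auto
  then have "measure (lebN d) ?N = 0" by (simp add: measure_le_0_iff)
  \<comment> \<open>\<open>measure\<close> is also 0 on sets of infinite measure, so finiteness is
    needed to conclude that the set is null.\<close>
  moreover have "emeasure (lebN d) ?N = ennreal (measure (lebN d) ?N)"
    using fin by (intro emeasure_eq_ennreal_measure) (rule less_imp_neq, simp only: infinity_ennreal_def)
  ultimately have "?N \<in> null_sets (lebN d)"
    using N by (intro null_setsI) (simp only: ennreal_0)
  then show ?thesis by (rule AE_I') auto
qed

text \<open>Positivity allows a positive \<open>v\<close> below the volume, and makes every
  \<open>v\<close> above it positive.\<close>

lemma ball_vol_pos: "ball_vol a b d > 0"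
proof -
  \<comment> \<open>The side lengths are chosen so that each of the \<open>d\<close> terms
    contributes at most \<open>1 / d\<close>; the box then fits into the unit ball.\<close>
  define \<epsilon> where "\<epsilon> j = (1 / (real d * a j)) powr (1 / (2 * b j))" for j
  have \<epsilon>: "\<epsilon> j > 0" "a j * \<epsilon> j powr (2 * b j) = 1 / real d" if "j \<in> {1..d}" for j
    using a[OF that] b[OF that] d by (simp_all add: \<epsilon>_def powr_powr)
  define Q where "Q = PiE {1..d} (\<lambda>j. {0..\<epsilon> j})"
  have "emeasure (lebN d) Q = (\<Prod>j\<in>{1..d}. emeasure lborel {0..\<epsilon> j})"
    unfolding Q_def lebN_def by (rule lebs.emeasure_PiM) auto
  also have "\<dots> = ennreal (\<Prod>j\<in>{1..d}. \<epsilon> j)"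
  proof -
    have "emeasure lborel {0..\<epsilon> j} = ennreal (\<epsilon> j)" if "j \<in> {1..d}" for j
      using \<epsilon>(1)[OF that] by simp
    then show ?thesis
      using \<epsilon>(1) by (subst prod_ennreal[symmetric]) (auto intro!: prod.cong less_imp_le)
  qed
  finally have "measure (lebN d) Q = (\<Prod>j\<in>{1..d}. \<epsilon> j)"
    unfolding measure_def by (simp only: enn2real_ennreal prod_nonneg less_imp_le[OF \<epsilon>(1)])
  moreover have "0 < (\<Prod>j\<in>{1..d}. \<epsilon> j)" by (rule prod_pos) (rule \<epsilon>(1))
  ultimately have "0 < measure (lebN d) Q" by (simp only:)
  also have "\<dots> \<le> measure (lebN d) (aniso_ball 1)"
  proof (rule measure_mono_fmeasurable)
    show "Q \<subseteq> aniso_ball 1"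
    proof
      fix x assume x: "x \<in> Q"
      have "\<phi> x \<le> (\<Sum>j\<in>{1..d}. 1 / real d)"
        unfolding aniso_def
      proof (rule sum_mono)
        fix j assume j: "j \<in> {1..d}"
        then have "0 \<le> x j" "x j \<le> \<epsilon> j" using x by (auto simp: Q_def PiE_iff)
        then have "a j * \<bar>x j\<bar> powr (2 * b j) \<le> a j * \<epsilon> j powr (2 * b j)"
          using a[OF j] b[OF j] by (intro mult_left_mono powr_mono2) auto
        then show "a j * \<bar>x j\<bar> powr (2 * b j) \<le> 1 / real d" using \<epsilon>(2)[OF j] by simp
      qed
      also have "\<dots> = 1" using d by simp
      finally show "x \<in> aniso_ball 1" using x by (auto simp: aniso_ball_def space_lebN Q_def PiE_iff)
    qed
    show "Q \<in> sets (lebN d)" unfolding Q_def lebN_def by (rule sets_PiM_I_finite) auto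
    show "aniso_ball 1 \<in> fmeasurable (lebN d)"
      using aniso_ball_sets emeasure_ball_1 by (intro fmeasurableI) auto
  qed
  finally show ?thesis by (simp add: ball_vol_eq)
qed

text \<open>For positive \<open>t\<close>, dividing by the dilation factors moves the points into
  the unit ball, whose coordinates are bounded. For other \<open>t\<close> only the zero frequency
  can remain.\<close>

lemma finite_lattice_ball: "finite (lattice_ball a b d t)"
proof (cases "t > 0")
  case True
  define R where "R j = \<lceil>dil b t j * (1 / a j) powr (1 / (2 * b j))\<rceil>" for j
  have "lattice_ball a b d t \<subseteq> PiE {1..d} (\<lambda>j. {- R j .. R j})"
  proof
    fix k assume "k \<in> lattice_ball a b d t"
    then have k: "k \<in> freq d" "\<phi> (\<lambda>j. real_of_int (k j)) \<le> t" by (auto simp: lattice_ball_def)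
    have "\<phi> (\<lambda>j. real_of_int (k j)) = t * \<phi> (\<lambda>j. real_of_int (k j) / dil b t j)"
      using dil_pos[OF True] by (subst aniso_dil[OF True, symmetric]) (simp add: less_imp_neq[symmetric])
    then have le: "\<phi> (\<lambda>j. real_of_int (k j) / dil b t j) \<le> 1" using k(2) True by simp
    show "k \<in> PiE {1..d} (\<lambda>j. {- R j .. R j})"
    proof (rule PiE_I)
      fix j assume "j \<in> {1..d}"
      from aniso_le_1_bound[OF le this]
      have "\<bar>real_of_int (k j)\<bar> \<le> dil b t j * (1 / a j) powr (1 / (2 * b j))"
        using dil_pos[OF True, of j] by (simp add: abs_divide field_simps)
      then have "real_of_int \<bar>k j\<bar> \<le> real_of_int (R j)"
        unfolding R_def by (simp add: order_trans[OF _ le_of_int_ceiling])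
      then have "\<bar>k j\<bar> \<le> R j" by (simp only: of_int_le_iff)
      then show "k j \<in> {- R j .. R j}" by auto
    qed (use k in \<open>auto simp: freq_def\<close>)
  qed
  then show ?thesis by (rule finite_subset) (auto intro: finite_PiE)
next
  case False
  have "k \<in> {\<lambda>j\<in>{1..d}. 0}" if "k \<in> lattice_ball a b d t" for k
  proof -
    from that have k: "k \<in> freq d" "\<phi> (\<lambda>j. real_of_int (k j)) \<le> t" by (auto simp: lattice_ball_def)
    have "k j = 0" if j: "j \<in> {1..d}" for j
    proof (rule ccontr)
      assume "k j \<noteq> 0"
      then have "0 < a j * \<bar>real_of_int (k j)\<bar> powr (2 * b j)" using a[OF j] by simp
      then show False using aniso_term_le[OF j, of "\<lambda>j. real_of_int (k j)"] k(2) False by linarith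
    qed
    then show ?thesis using k(1) by (auto simp: freq_def fun_eq_iff PiE_iff extensional_def)
  qed
  then show ?thesis by (meson finite.simps finite_subset subsetI)
qed

text \<open>Attach to each lattice point the unit cell of points whose floor it is. Half-open cells
  are disjoint and have volume 1, so this is an exact identity without boundary terms.\<close>

lemma card_lattice_ball:
  "real (card (lattice_ball a b d t)) =
    measure (lebN d) {x \<in> space (lebN d). \<phi> (\<lambda>j. real_of_int \<lfloor>x j\<rfloor>) \<le> t}"
proof -
  define cell where "cell k = PiE {1..d} (\<lambda>j. {real_of_int (k j)..<real_of_int (k j) + 1})" for k
  have emc: "emeasure (lebN d) (cell k) = 1" for k
    unfolding cell_def lebN_def by (subst lebs.emeasure_PiM) auto
  have mem: "x \<in> cell k \<longleftrightarrow> x \<in> space (lebN d) \<and> (\<forall>j\<in>{1..d}. \<lfloor>x j\<rfloor> = k j)" for x k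
    by (auto simp: cell_def space_lebN PiE_iff floor_eq_iff)
  have "{x \<in> space (lebN d). \<phi> (\<lambda>j. real_of_int \<lfloor>x j\<rfloor>) \<le> t} = (\<Union>k\<in>lattice_ball a b d t. cell k)"
    (is "?L = ?R")
  proof (intro equalityI subsetI)
    fix x assume x: "x \<in> ?L"
    define k where "k = (\<lambda>j\<in>{1..d}. \<lfloor>x j\<rfloor>)"
    have "\<phi> (\<lambda>j. real_of_int (k j)) = \<phi> (\<lambda>j. real_of_int \<lfloor>x j\<rfloor>)"
      by (rule aniso_cong) (simp add: k_def)
    then have "k \<in> lattice_ball a b d t" using x by (auto simp: lattice_ball_def freq_def k_def)
    moreover have "x \<in> cell k" using x by (simp add: mem k_def)
    ultimately show "x \<in> ?R" by blast
  next
    fix x assume "x \<in> ?R"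
    then obtain k where k: "k \<in> lattice_ball a b d t" "x \<in> cell k" by blast
    have "\<phi> (\<lambda>j. real_of_int (k j)) = \<phi> (\<lambda>j. real_of_int \<lfloor>x j\<rfloor>)"
      by (rule aniso_cong) (use k in \<open>simp add: mem\<close>)
    then show "x \<in> ?L" using k by (simp add: mem lattice_ball_def)
  qed
  also have "measure (lebN d) (\<Union>k\<in>lattice_ball a b d t. cell k) =
      (\<Sum>k\<in>lattice_ball a b d t. measure (lebN d) (cell k))"
  proof (rule measure_finite_Union[OF finite_lattice_ball])
    show "cell ` lattice_ball a b d t \<subseteq> sets (lebN d)"
      unfolding cell_def lebN_def by (auto intro!: sets_PiM_I_finite)
    show "disjoint_family_on cell (lattice_ball a b d t)"
      unfolding disjoint_family_on_def
    proof (intro ballI impI)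
      fix k l assume kl: "k \<in> lattice_ball a b d t" "l \<in> lattice_ball a b d t" "k \<noteq> l"
      then have "k \<in> extensional {1..d}" "l \<in> extensional {1..d}"
        by (auto simp: lattice_ball_def freq_def PiE_def)
      with kl(3) obtain j where "j \<in> {1..d}" "k j \<noteq> l j" by (meson extensionalityI)
      then show "cell k \<inter> cell l = {}" by (auto simp: mem)
    qed
  qed (simp add: emc)
  also have "\<dots> = real (card (lattice_ball a b d t))"
    by (simp add: measure_def emc)
  finally show ?thesis ..
qed

lemma dil_at_top:
  assumes "j \<in> {1..d}"
  shows "filterlim (\<lambda>t. dil b t j) at_top at_top"
proof -
  have "filterlim (\<lambda>t. exp (1 / (2 * b j) * ln t)) at_top at_top"
    using b[OF assms]
    by (intro filterlim_compose[OF exp_at_top] filterlim_tendsto_pos_mult_at_top[OF tendsto_const _ ln_at_top])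
       simp
  moreover have "eventually (\<lambda>t. exp (1 / (2 * b j) * ln t) = dil b t j) at_top"
    using eventually_gt_at_top[of 0] by eventually_elim (simp add: dil_def powr_def)
  ultimately show ?thesis by (simp add: filterlim_cong)
qed

lemma lattice_rounding_error:
  assumes "c > 0"
  shows "\<bar>real_of_int \<lfloor>c * y\<rfloor> / c - y\<bar> \<le> 1 / c"
proof -
  have "\<bar>real_of_int \<lfloor>c * y\<rfloor> - c * y\<bar> \<le> 1" by linarith
  then have "\<bar>real_of_int \<lfloor>c * y\<rfloor> - c * y\<bar> / c \<le> 1 / c" using assms by (simp add: divide_right_mono)
  moreover have "real_of_int \<lfloor>c * y\<rfloor> / c - y = (real_of_int \<lfloor>c * y\<rfloor> - c * y) / c"
    using assms by (simp add: field_simps)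
  ultimately show ?thesis using assms by (simp add: abs_divide)
qed

lemma aniso_rounded_tendsto:
  "((\<lambda>t. \<phi> (\<lambda>j. real_of_int \<lfloor>dil b t j * y j\<rfloor> / dil b t j)) \<longlongrightarrow> \<phi> y) at_top"
  unfolding aniso_def
proof (intro tendsto_sum tendsto_mult tendsto_const)
  fix j assume j: "j \<in> {1..d}"
  have "((\<lambda>t. real_of_int \<lfloor>dil b t j * y j\<rfloor> / dil b t j - y j) \<longlongrightarrow> 0) at_top"
  proof (rule Lim_null_comparison)
    show "\<forall>\<^sub>F t in at_top. norm (real_of_int \<lfloor>dil b t j * y j\<rfloor> / dil b t j - y j) \<le> 1 / dil b t j"
      using eventually_gt_at_top[of 0]
      by eventually_elim (simp add: lattice_rounding_error dil_pos)
    show "((\<lambda>t. 1 / dil b t j) \<longlongrightarrow> 0) at_top"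
      by (rule tendsto_divide_0[OF tendsto_const filterlim_at_top_imp_at_infinity[OF dil_at_top[OF j]]])
  qed
  then have "((\<lambda>t. real_of_int \<lfloor>dil b t j * y j\<rfloor> / dil b t j) \<longlongrightarrow> y j) at_top"
    by (simp add: LIM_zero_iff)
  then show "((\<lambda>t. \<bar>real_of_int \<lfloor>dil b t j * y j\<rfloor> / dil b t j\<bar> powr (2 * b j)) \<longlongrightarrow> \<bar>y j\<bar> powr (2 * b j)) at_top"
    \<comment> \<open>The base \<open>\<bar>y j\<bar>\<close> may be 0; continuity of the power
      there relies on the positive exponent.\<close>
    using b[OF j] by (intro tendsto_powr' tendsto_rabs tendsto_const) auto
qed

lemma lattice_ball_asymptotics:
  "((\<lambda>t. real (card (lattice_ball a b d t)) / t powr \<sigma>) \<longlongrightarrow> ball_vol a b d) at_top"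
proof -
  \<comment> \<open>The set counted by \<open>card_lattice_ball\<close>, pulled back along the
    dilation; its measure is the lattice count divided by \<open>t powr \<sigma>\<close>.\<close>
  define S where "S t = {x \<in> space (lebN d). \<phi> (\<lambda>j. real_of_int \<lfloor>dil b t j * x j\<rfloor>) \<le> t}" for t
  have S_sets: "S t \<in> sets (lebN d)" for t
    unfolding S_def
  proof (rule aniso_le_sets[where f="\<lambda>x j. real_of_int \<lfloor>dil b t j * x j\<rfloor>"])
    fix j assume j: "j \<in> {1..d}"
    have "(\<lambda>y. real_of_int \<lfloor>dil b t j * y\<rfloor>) \<in> borel_measurable borel" by measurable
    then show "(\<lambda>x. real_of_int \<lfloor>dil b t j * x j\<rfloor>) \<in> borel_measurable (lebN d)"
      by (rule measurable_compose[OF measurable_component_lebN[OF j]])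
  qed
  have S_iff: "x \<in> S t \<longleftrightarrow> x \<in> space (lebN d) \<and> \<phi> (\<lambda>j. real_of_int \<lfloor>dil b t j * x j\<rfloor> / dil b t j) \<le> 1"
    if "t > 0" for x t
  proof -
    have "\<phi> (\<lambda>j. real_of_int \<lfloor>dil b t j * x j\<rfloor>) =
        t * \<phi> (\<lambda>j. real_of_int \<lfloor>dil b t j * x j\<rfloor> / dil b t j)"
      using dil_pos[OF that] by (subst aniso_dil[OF that, symmetric]) (simp add: less_imp_neq[symmetric])
    then show ?thesis using that by (simp add: S_def)
  qed
  have "((\<lambda>t. \<integral>x. indicator (S t) x \<partial>lebN d) \<longlongrightarrow> (\<integral>x. indicator (aniso_ball 1) x \<partial>lebN d :: real)) at_top"
  proof (rule integral_dominated_convergence_at_top)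
    show "integrable (lebN d) (indicator bounding_box :: _ \<Rightarrow> real)"
      using bounding_box_sets emeasure_box by (simp add: integrable_indicator_iff)
    show "AE x in lebN d. ((\<lambda>t. indicator (S t) x :: real) \<longlongrightarrow> indicator (aniso_ball 1) x) at_top"
      using AE_aniso_neq_1 AE_space
    proof eventually_elim
      fix x assume ne: "\<phi> x \<noteq> 1" and sp: "x \<in> space (lebN d)"
      have pos: "eventually (\<lambda>t::real. t > 0) at_top" by (rule eventually_gt_at_top)
      \<comment> \<open>Away from the boundary the rounded value ends up on the same side of 1 as
        \<open>\<phi> x\<close>, so the indicators are eventually constant.\<close>
      have "eventually (\<lambda>t. indicator (S t) x = (indicator (aniso_ball 1) x :: real)) at_top"
      proof (cases "\<phi> x < 1")
        case True
        from order_tendstoD(2)[OF aniso_rounded_tendsto True] pos show ?thesis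
          by eventually_elim (use True sp in \<open>simp add: indicator_def S_iff aniso_ball_def\<close>)
      next
        case False
        then have "\<phi> x > 1" using ne by simp
        from order_tendstoD(1)[OF aniso_rounded_tendsto this] pos show ?thesis
          by eventually_elim (use \<open>\<phi> x > 1\<close> in \<open>simp add: indicator_def S_iff aniso_ball_def\<close>)
      qed
      then show "((\<lambda>t. indicator (S t) x :: real) \<longlongrightarrow> indicator (aniso_ball 1) x) at_top"
        by (rule tendsto_eventually)
    qed
    show "\<forall>\<^sub>F t in at_top. AE x in lebN d. norm (indicator (S t) x :: real) \<le> indicator bounding_box x"
      using eventually_ge_at_top[of 1]
    proof eventually_elim
      fix t :: real assume t: "1 \<le> t"
      have "S t \<subseteq> bounding_box"
      proof
        fix x assume "x \<in> S t"
        then have x: "x \<in> space (lebN d)" "\<phi> (\<lambda>j. real_of_int \<lfloor>dil b t j * x j\<rfloor> / dil b t j) \<le> 1"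
          using S_iff[of t x] t by auto
        show "x \<in> bounding_box" unfolding bounding_box_def
        proof (rule PiE_I)
          fix j assume j: "j \<in> {1..d}"
          have "dil b t j \<ge> 1" unfolding dil_def using t b[OF j] by (intro ge_one_powr_ge_zero) auto
          then have "\<bar>real_of_int \<lfloor>dil b t j * x j\<rfloor> / dil b t j - x j\<bar> \<le> 1"
            using lattice_rounding_error[of "dil b t j" "x j"] by (smt (verit) divide_le_eq_1)
          then have "\<bar>x j\<bar> \<le> (1 / a j) powr (1 / (2 * b j)) + 1"
            using aniso_le_1_bound[OF x(2) j] by linarith
          then show "x j \<in> {- ((1 / a j) powr (1 / (2 * b j)) + 1) .. (1 / a j) powr (1 / (2 * b j)) + 1}"
            by (auto simp: abs_le_iff)
        qed (use x in \<open>auto simp: space_lebN\<close>)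
      qed
      then show "AE x in lebN d. norm (indicator (S t) x :: real) \<le> indicator bounding_box x"
        by (intro AE_I2) (auto simp: indicator_def)
    qed
  qed (use S_sets aniso_ball_sets in auto)
  then have "((\<lambda>t. measure (lebN d) (S t)) \<longlongrightarrow> ball_vol a b d) at_top"
    using sets.sets_into_space[OF S_sets] sets.sets_into_space[OF aniso_ball_sets]
    by (simp add: ball_vol_eq Int_absorb2)
  then show ?thesis
  proof (rule Lim_transform_eventually)
    show "\<forall>\<^sub>F t in at_top. measure (lebN d) (S t) = real (card (lattice_ball a b d t)) / t powr \<sigma>"
      using eventually_gt_at_top[of 0]
    proof eventually_elim
      fix t :: real assume t: "0 < t"
      have "(\<lambda>x::real. real_of_int \<lfloor>x\<rfloor>) \<in> borel_measurable borel" by measurable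
      from measure_coordinatewise_ball[OF this t, of t]
      show "measure (lebN d) (S t) = real (card (lattice_ball a b d t)) / t powr \<sigma>"
        using t by (simp add: card_lattice_ball S_def)
    qed
  qed
qed

end

section \<open>Asymptotics of the approximation numbers\<close>

context anisotropic begin

lemma g_exp_eq: "g_exp b d = 1 / (2 * \<sigma>)"
  by (simp add: g_exp_def vol_exp_def sum_distrib_left)

lemma sob_weight_eq: "sob_weight a b d k = 1 + \<phi> (\<lambda>j. real_of_int (k j))"
  by (simp add: sob_weight_def aniso_def)

text \<open>\<open>t n\<close> is the radius at which a ball with volume constant \<open>v\<close>
  would have volume exactly \<open>n\<close>. The last identity trades the normalising power of
  \<open>n\<close> for \<open>sqrt (t n)\<close>, the scale of the approximation number.\<close>

lemma scaled_radius:
  assumes "v > 0"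
  defines "t \<equiv> \<lambda>n. (real n / v) powr (1 / \<sigma>)"
  shows "filterlim t at_top sequentially"
    and "n \<ge> 1 \<Longrightarrow> t n > 0"
    and "n \<ge> 1 \<Longrightarrow> t n powr \<sigma> = real n / v"
    and "n \<ge> 1 \<Longrightarrow> real n powr g_exp b d = v powr g_exp b d * sqrt (t n)"
proof -
  show pos: "t n > 0" if "n \<ge> 1" for n using that assms by (simp add: t_def)
  show "t n powr \<sigma> = real n / v" if "n \<ge> 1" for n
    using that assms sigma_pos by (simp add: t_def powr_powr)
  show "real n powr g_exp b d = v powr g_exp b d * sqrt (t n)" if "n \<ge> 1"
  proof -
    have "sqrt (t n) = (real n / v) powr g_exp b d"
      using that assms sigma_pos pos[OF that]
      by (simp add: t_def powr_half_sqrt[symmetric] powr_powr g_exp_eq mult.commute)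
    then show ?thesis using that assms by (simp add: powr_mult[symmetric])
  qed
  have "filterlim (\<lambda>n. 1 / v * real n) at_top sequentially"
    by (rule filterlim_tendsto_pos_mult_at_top[OF tendsto_const _ filterlim_real_sequentially])
       (use assms in simp)
  then have "filterlim (\<lambda>n. ln (real n / v)) at_top sequentially"
    by (intro filterlim_compose[OF ln_at_top]) simp
  then have "filterlim (\<lambda>n. exp (1 / \<sigma> * ln (real n / v))) at_top sequentially"
    by (intro filterlim_compose[OF exp_at_top] filterlim_tendsto_pos_mult_at_top[OF tendsto_const])
       (use sigma_pos in auto)
  moreover have "eventually (\<lambda>n. exp (1 / \<sigma> * ln (real n / v)) = t n) sequentially"
    using eventually_gt_at_top[of 0] by eventually_elim (use assms in \<open>simp add: t_def powr_def\<close>)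
  ultimately show "filterlim t at_top sequentially"
    by (simp add: filterlim_cong)
qed

lemma approx_num_upper:
  assumes v: "v > ball_vol a b d"
  shows "\<forall>\<^sub>F n in sequentially. real n powr g_exp b d * approx_num a b d n \<le> v powr g_exp b d"
proof -
  have v0: "v > 0" using v ball_vol_pos by linarith
  define t where "t n = (real n / v) powr (1 / \<sigma>)" for n
  note t = scaled_radius[OF v0, folded t_def]
  have "\<forall>\<^sub>F n in sequentially. real (card (lattice_ball a b d (t n))) / t n powr \<sigma> < v"
    using filterlim_compose[OF lattice_ball_asymptotics t(1)] v by (rule order_tendstoD(2))
  then show ?thesis using eventually_ge_at_top[of 1]
  proof eventually_elim
    fix n :: nat assume n: "1 \<le> n" and "real (card (lattice_ball a b d (t n))) / t n powr \<sigma> < v"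
    then have "card (lattice_ball a b d (t n)) < n"
      using v0 by (simp add: t(3)[OF n] field_simps)
    \<comment> \<open>Outside the lattice ball the weight exceeds \<open>1 + t n\<close>; the weaker
      threshold \<open>t n\<close> suffices and gives a clean product.\<close>
    then have "approx_num a b d n \<le> 1 / sqrt (t n)"
      using t(2)[OF n]
      by (intro approx_num_le[OF d less_imp_le[OF a] finite_lattice_ball])
         (auto simp: lattice_ball_def sob_weight_eq)
    then have "sqrt (t n) * approx_num a b d n \<le> 1"
      using t(2)[OF n] by (simp add: field_simps)
    then have "v powr g_exp b d * (sqrt (t n) * approx_num a b d n) \<le> v powr g_exp b d * 1"
      by (intro mult_left_mono) auto
    then show "real n powr g_exp b d * approx_num a b d n \<le> v powr g_exp b d"
      by (simp add: t(4)[OF n] mult.assoc)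
  qed
qed

text \<open>Weights inside the ball reach \<open>1 + t n\<close>, so the bound obtained is
  \<open>v powr g_exp b d\<close> times \<open>sqrt (t n / (1 + t n))\<close>. It only tends to
  \<open>v powr g_exp b d\<close>, hence the extra slack \<open>u\<close>.\<close>

lemma approx_num_lower:
  assumes v: "0 < v" "v < ball_vol a b d" and u: "u < v powr g_exp b d"
  shows "\<forall>\<^sub>F n in sequentially. u < real n powr g_exp b d * approx_num a b d n"
proof -
  define t where "t n = (real n / v) powr (1 / \<sigma>)" for n
  note t = scaled_radius[OF v(1), folded t_def]
  have ev1: "\<forall>\<^sub>F n in sequentially. v < real (card (lattice_ball a b d (t n))) / t n powr \<sigma>"
    using filterlim_compose[OF lattice_ball_asymptotics t(1)] v(2) by (rule order_tendstoD(1))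
  \<comment> \<open>\<open>1 - inverse (1 + s)\<close> is \<open>s / (1 + s)\<close>, written so
    that the limit can be read off.\<close>
  have "((\<lambda>s. sqrt (1 - inverse (1 + s))) \<longlongrightarrow> sqrt (1 - 0)) at_top"
    by (intro tendsto_intros tendsto_inverse_0_at_top filterlim_tendsto_add_at_top[OF tendsto_const filterlim_ident])
  then have "((\<lambda>s. v powr g_exp b d * sqrt (1 - inverse (1 + s))) \<longlongrightarrow> v powr g_exp b d * sqrt (1 - 0)) at_top"
    by (rule tendsto_mult[OF tendsto_const])
  from filterlim_compose[OF this t(1)]
  have "(\<lambda>n. v powr g_exp b d * sqrt (1 - inverse (1 + t n))) \<longlonglongrightarrow> v powr g_exp b d" by simp
  then have ev2: "\<forall>\<^sub>F n in sequentially. u < v powr g_exp b d * sqrt (1 - inverse (1 + t n))"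
    using u by (rule order_tendstoD(1))
  show ?thesis using ev1 ev2 eventually_ge_at_top[of 1]
  proof eventually_elim
    fix n :: nat assume n: "1 \<le> n" and 1: "v < real (card (lattice_ball a b d (t n))) / t n powr \<sigma>"
      and 2: "u < v powr g_exp b d * sqrt (1 - inverse (1 + t n))"
    have "n \<le> card (lattice_ball a b d (t n))"
      using 1 v n by (simp add: t(3)[OF n] field_simps)
    then have ge: "1 / sqrt (1 + t n) \<le> approx_num a b d n"
      by (intro approx_num_ge[OF d n less_imp_le[OF a] finite_lattice_ball])
         (auto simp: lattice_ball_def sob_weight_eq)
    have "sqrt (1 - inverse (1 + t n)) = sqrt (t n) * (1 / sqrt (1 + t n))"
      using t(2)[OF n] by (simp add: real_sqrt_divide[symmetric] field_simps)
    also have "\<dots> \<le> sqrt (t n) * approx_num a b d n"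
      using ge t(2)[OF n] by (intro mult_left_mono) auto
    finally have "v powr g_exp b d * sqrt (1 - inverse (1 + t n)) \<le>
        v powr g_exp b d * (sqrt (t n) * approx_num a b d n)"
      by (intro mult_left_mono) auto
    with 2 show "u < real n powr g_exp b d * approx_num a b d n"
      by (simp add: t(4)[OF n] mult.assoc)
  qed
qed

lemma approx_num_asymptotics:
  "(\<lambda>n. real n powr g_exp b d * approx_num a b d n) \<longlonglongrightarrow> ball_vol a b d powr g_exp b d"
proof (rule order_tendstoI)
  let ?V = "ball_vol a b d" and ?g = "g_exp b d"
  have g: "?g > 0" using sigma_pos by (simp add: g_exp_eq)
  fix u
  {
    assume u: "?V powr ?g < u"
    then have u0: "0 < u" using powr_ge_zero[of ?V ?g] by linarith
    \<comment> \<open>Applying the inverse power turns the gap between limit and \<open>u\<close>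
      into a gap next to the volume, where \<open>v\<close> can be chosen by density.\<close>
    have "(?V powr ?g) powr (1 / ?g) < u powr (1 / ?g)"
      using u g by (intro powr_less_mono2) auto
    then obtain v where v: "?V < v" "v < u powr (1 / ?g)"
      using g ball_vol_pos dense by (auto simp: powr_powr)
    have "v powr ?g < (u powr (1 / ?g)) powr ?g"
      using v g ball_vol_pos by (intro powr_less_mono2) auto
    then have "v powr ?g < u" using g u0 by (simp add: powr_powr)
    with approx_num_upper[OF v(1)]
    show "\<forall>\<^sub>F n in sequentially. real n powr ?g * approx_num a b d n < u"
      by (auto elim!: eventually_mono)
  next
    assume u: "u < ?V powr ?g"
    \<comment> \<open>Negative \<open>u\<close> are replaced by 0, since the inverse power is
      monotone only on nonnegative reals.\<close>
    define w where "w = max u 0"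
    have w: "0 \<le> w" "u \<le> w" "w < ?V powr ?g" using u ball_vol_pos by (auto simp: w_def)
    have "w powr (1 / ?g) < (?V powr ?g) powr (1 / ?g)"
      using w g by (intro powr_less_mono2) auto
    then obtain v where v: "w powr (1 / ?g) < v" "v < ?V"
      using g ball_vol_pos dense by (auto simp: powr_powr)
    have v0: "0 < v" using v(1) powr_ge_zero[of w "1 / ?g"] by linarith
    have "(w powr (1 / ?g)) powr ?g < v powr ?g"
      using v g by (intro powr_less_mono2) auto
    then have "u < v powr ?g" using g w by (simp add: powr_powr)
    then show "\<forall>\<^sub>F n in sequentially. u < real n powr ?g * approx_num a b d n"
      by (rule approx_num_lower[OF v0 v(2)])
  }
qed

end

theorem theorem2p2:
  fixes a b :: "nat \<Rightarrow> real" and d :: nat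
  assumes "\<forall>j\<ge>1. a j > 0" and "\<forall>j\<ge>1. b j > 0" and "d \<ge> 1"
  shows "(\<lambda>n. real n powr g_exp b d * approx_num a b d n)
           \<longlonglongrightarrow> (ball_vol a b d) powr g_exp b d"
proof -
  interpret anisotropic a b d
    by unfold_locales (use assms in auto)
  show ?thesis by (rule approx_num_asymptotics)
qed

end
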